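(* Let $\mathfrak M$ be a closed O*-algebra on a dense subspace $\mathcal D$ of a Hilbert space $\mathcal H$ such that $\mathcal D$ is a Fréchet domain of $\mathfrak M$, and assume $\mathfrak M'_{\mathrm w}\mathcal D\subset\mathcal D$. Let $E'$ be a projection in $\mathfrak M'_{\mathrm w}$ and assume that the subspace $\langle\mathfrak M'_{\mathrm w}E'\mathcal D\rangle$ is essentially self-adjoint for $\mathfrak M''_{\mathrm{wc}}$. Then $(\mathfrak M_{E'})''_{\mathrm{wc}}=(\mathfrak M''_{\mathrm{wc}})_{E'}$.
   Context: For a dense subspace $\mathcal D$ of $\mathcal H$, $\mathcal L^\dagger(\mathcal D)$ is the set of linear operators $X$ with domain $\mathcal D$ such that $X\mathcal D\subset\mathcal D$, $\mathcal D\subset D(X^* )$, $X^*\mathcal D\subset\mathcal D$, a *-algebra with involution $X^\dagger:=X^*\upharpoonright\mathcal D$. An O*-algebra on $\mathcal D$ is a *-subalgebra of $\mathcal L^\dagger(\mathcal D)$ containing the identity. The graph topology $t_{\mathfrak M}$ is defined by the seminorms $\xi\mapsto\|X\xi\|$, $X\in\mathfrak M$; $\mathfrak M$ is closed if $\mathcal D[t_{\mathfrak M}]$ is complete, and $\mathcal D$ is a Fréchet domain of $\mathfrak M$ if $\mathcal D[t_{\mathfrak M}]$ is a Fréchet space. Weak commutant: $\mathfrak M'_{\mathrm w}=\{C\in\mathcal B(\mathcal H):\langle CX\xi,\eta\rangle=\langle C\xi,X^\dagger\eta\rangle\ \forall X\in\mathfrak M,\ \xi,\eta\in\mathcal D\}$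 (a von Neumann algebra when $\mathfrak M'_{\mathrm w}\mathcal D\subset\mathcal D$). Unbounded bicommutant: $\mathfrak M''_{\mathrm{wc}}=\{X\in\mathcal L^\dagger(\mathcal D):\langle CX\xi,\eta\rangle=\langle C\xi,X^\dagger\eta\rangle\ \forall C\in\mathfrak M'_{\mathrm w},\ \xi,\eta\in\mathcal D\}$. For an O*-algebra $\mathfrak N$ on $\mathcal D$ and a projection $E'\in\mathfrak N'_{\mathrm w}$ with $E'\mathcal D\subset\mathcal D$, the reduced algebra is $\mathfrak N_{E'}=\{XE'\upharpoonright E'\mathcal D: X\in\mathfrak N\}$, an O*-algebra on $E'\mathcal D$ in $E'\mathcal H$; $(\mathfrak M_{E'})''_{\mathrm{wc}}$ is its unbounded bicommutant computed relative to $E'\mathcal D\subset E'\mathcal H$. $\langle\cdot\rangle$ denotes linear span. For an O*-algebra $\mathfrak N$ on a dense subspace $\mathcal K$ of a Hilbert space, put $\widetilde{\mathcal K}(\mathfrak N)=\bigcap_{X\in\mathfrak N}D(\overline X)$ and $\mathcal K^*(\mathfrak N)=\bigcap_{X\in\mathfrak N}D(X^* )$; $\mathfrak N$ is essentially self-adjoint if $\widetilde{\mathcal K}(\mathfrak N)=\mathcal K^*(\mathfrak N)$. A subspace $\mathcal M\subset\mathcal D$ with $X\mathcal M\subset\mathcal M$ for all $X\in\mathfrak N$ is essentially self-adjoint for $\mathfrak N$ if the O*-algebra $\{X\upharpoonright\mathcal M: X\in\mathfrak N\}$ on $\mathcal M$ (in the Hilbert space $\overline{\mathcal M}$) is essentially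 self-adjoint. *)

theory Defs
  imports "HOL-Analysis.Analysis"
begin

class complex_vector = real_vector +
  fixes scaleC :: "complex \<Rightarrow> 'a \<Rightarrow> 'a" (infixr \<open>*\<^sub>C\<close> 75)
  assumes scaleC_add_right: "a *\<^sub>C (x + y) = a *\<^sub>C x + a *\<^sub>C y"
    and scaleC_add_left: "(a + b) *\<^sub>C x = a *\<^sub>C x + b *\<^sub>C x"
    and scaleC_scaleC: "a *\<^sub>C (b *\<^sub>C x) = (a * b) *\<^sub>C x"
    and scaleC_one: "1 *\<^sub>C x = x"
    and scaleR_scaleC: "scaleR r x = complex_of_real r *\<^sub>C x"

class complex_inner = complex_vector + real_normed_vector +
  fixes cinner :: "'a \<Rightarrow> 'a \<Rightarrow> complex"
  assumes cinner_commute: "cinner x y = cnj (cinner y x)"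
    and cinner_add_left: "cinner (x + y) z = cinner x z + cinner y z"
    and cinner_scaleC_left: "cinner (a *\<^sub>C x) y = a * cinner x y"
    and cinner_nonneg: "0 \<le> Re (cinner x x)"
    and cinner_eq_zero_iff: "cinner x x = 0 \<longleftrightarrow> x = 0"
    and norm_eq_sqrt_cinner: "norm x = sqrt (Re (cinner x x))"

class chilbert = complex_inner + complete_space

definition csubspace :: "'a::complex_vector set \<Rightarrow> bool" where
  "csubspace S \<longleftrightarrow> 0 \<in> S \<and> (\<forall>x\<in>S. \<forall>y\<in>S. x + y \<in> S) \<and> (\<forall>a. \<forall>x\<in>S. a *\<^sub>C x \<in> S)"

definition cspan :: "'a::complex_vector set \<Rightarrow> 'a set" where
  "cspan S = \<Inter>{T. csubspace T \<and> S \<subseteq> T}"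

definition bounded_clinear :: "('a::complex_inner \<Rightarrow> 'a) \<Rightarrow> bool" where
  "bounded_clinear C \<longleftrightarrow> (\<forall>x y. C (x + y) = C x + C y) \<and> (\<forall>a x. C (a *\<^sub>C x) = a *\<^sub>C C x)
     \<and> (\<exists>K. \<forall>x. norm (C x) \<le> norm x * K)"

text \<open>Setting: a closed subspace K (the Hilbert space) and a dense subspace D of K.
  Operators with domain D are functions normalised to be 0 outside D.\<close>

definition dense_domain :: "'a::chilbert set \<Rightarrow> 'a set \<Rightarrow> bool" where
  "dense_domain K D \<longleftrightarrow> csubspace K \<and> closed K \<and> csubspace D \<and> D \<subseteq> K \<and> K \<subseteq> closure D"

definition Ldag :: "'a::chilbert set \<Rightarrow> 'a set \<Rightarrow> ('a \<Rightarrow> 'a) set" where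
  "Ldag K D = {X. (\<forall>x. x \<notin> D \<longrightarrow> X x = 0)
      \<and> (\<forall>x\<in>D. \<forall>y\<in>D. X (x + y) = X x + X y) \<and> (\<forall>a. \<forall>x\<in>D. X (a *\<^sub>C x) = a *\<^sub>C X x)
      \<and> X ` D \<subseteq> D
      \<and> (\<forall>y\<in>D. \<exists>z\<in>D. \<forall>x\<in>D. cinner (X x) y = cinner x z)}"
  \<comment> \<open>the last clause: D \<subseteq> D(X*) and X* D \<subseteq> D, X* the adjoint in the Hilbert space K \<supseteq> D\<close>

definition dagger :: "'a::chilbert set \<Rightarrow> ('a \<Rightarrow> 'a) \<Rightarrow> ('a \<Rightarrow> 'a)" where
  "dagger D X = (\<lambda>y. if y \<in> D then (THE z. z \<in> D \<and> (\<forall>x\<in>D. cinner (X x) y = cinner x z)) else 0)"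

definition idD :: "'a::chilbert set \<Rightarrow> ('a \<Rightarrow> 'a)" where
  "idD D = (\<lambda>x. if x \<in> D then x else 0)"

definition Oalg :: "'a::chilbert set \<Rightarrow> 'a set \<Rightarrow> ('a \<Rightarrow> 'a) set \<Rightarrow> bool" where
  "Oalg K D M \<longleftrightarrow> M \<subseteq> Ldag K D \<and> idD D \<in> M
     \<and> (\<forall>X\<in>M. \<forall>Y\<in>M. (\<lambda>x. X x + Y x) \<in> M)
     \<and> (\<forall>a. \<forall>X\<in>M. (\<lambda>x. a *\<^sub>C X x) \<in> M)
     \<and> (\<forall>X\<in>M. \<forall>Y\<in>M. X \<circ> Y \<in> M)
     \<and> (\<forall>X\<in>M. dagger D X \<in> M)"

definition graph_complete :: "'a::chilbert set \<Rightarrow> ('a \<Rightarrow> 'a) set \<Rightarrow> bool" where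
  "graph_complete D M \<longleftrightarrow>
     (\<forall>F. F \<noteq> bot \<and> eventually (\<lambda>x. x \<in> D) F
        \<and> (\<forall>X\<in>M. \<forall>e>0. eventually (\<lambda>(x, y). norm (X x - X y) < e) (F \<times>\<^sub>F F))
        \<longrightarrow> (\<exists>\<xi>\<in>D. \<forall>X\<in>M. \<forall>e>0. eventually (\<lambda>x. norm (X x - X \<xi>) < e) F))"

definition closed_Oalg :: "'a::chilbert set \<Rightarrow> 'a set \<Rightarrow> ('a \<Rightarrow> 'a) set \<Rightarrow> bool" where
  "closed_Oalg K D M \<longleftrightarrow> Oalg K D M \<and> graph_complete D M"

text \<open>Metrizability of the locally convex (Hausdorff) space D[t_M]: a countable
  fundamental system of the defining seminorms.\<close>
definition graph_metrizable :: "'a::chilbert set \<Rightarrow> ('a \<Rightarrow> 'a) set \<Rightarrow> bool" where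
  "graph_metrizable D M \<longleftrightarrow> (\<exists>Xs::nat \<Rightarrow> ('a \<Rightarrow> 'a). range Xs \<subseteq> M \<and>
      (\<forall>X\<in>M. \<exists>n c. \<forall>\<xi>\<in>D. norm (X \<xi>) \<le> c * (\<Sum>k\<le>n. norm (Xs k \<xi>))))"

definition frechet_domain :: "'a::chilbert set \<Rightarrow> ('a \<Rightarrow> 'a) set \<Rightarrow> bool" where
  "frechet_domain D M \<longleftrightarrow> graph_complete D M \<and> graph_metrizable D M"

definition wcomm :: "'a::chilbert set \<Rightarrow> 'a set \<Rightarrow> ('a \<Rightarrow> 'a) set \<Rightarrow> ('a \<Rightarrow> 'a) set" where
  "wcomm K D M = {C. bounded_clinear C \<and> C ` K \<subseteq> K \<and>
      (\<forall>X\<in>M. \<forall>\<xi>\<in>D. \<forall>\<eta>\<in>D. cinner (C (X \<xi>)) \<eta> = cinner (C \<xi>) (dagger D X \<eta>))}"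
  \<comment> \<open>bounded operators on K, represented by bounded operators on the ambient space leaving K invariant\<close>

definition wcc :: "'a::chilbert set \<Rightarrow> 'a set \<Rightarrow> ('a \<Rightarrow> 'a) set \<Rightarrow> ('a \<Rightarrow> 'a) set" where
  "wcc K D M = {X \<in> Ldag K D. \<forall>C\<in>wcomm K D M. \<forall>\<xi>\<in>D. \<forall>\<eta>\<in>D.
      cinner (C (X \<xi>)) \<eta> = cinner (C \<xi>) (dagger D X \<eta>)}"

definition is_projection :: "('a::chilbert \<Rightarrow> 'a) \<Rightarrow> bool" where
  "is_projection E \<longleftrightarrow> bounded_clinear E \<and> (\<forall>x. E (E x) = E x) \<and> (\<forall>x y. cinner (E x) y = cinner x (E y))"

definition reduced :: "('a::chilbert \<Rightarrow> 'a) \<Rightarrow> 'a set \<Rightarrow> ('a \<Rightarrow> 'a) set \<Rightarrow> ('a \<Rightarrow> 'a) set" where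
  "reduced E D N = (\<lambda>X. \<lambda>x. if x \<in> E ` D then X (E x) else 0) ` N"

text \<open>For an operator X with domain S in the Hilbert space closure S.\<close>
definition closure_dom :: "'a::chilbert set \<Rightarrow> ('a \<Rightarrow> 'a) \<Rightarrow> 'a set" where
  "closure_dom S X = {\<xi>. \<exists>f. (\<forall>n. f n \<in> S) \<and> f \<longlonglongrightarrow> \<xi> \<and> convergent (\<lambda>n. X (f n))}"

definition adj_dom :: "'a::chilbert set \<Rightarrow> ('a \<Rightarrow> 'a) \<Rightarrow> 'a set" where
  "adj_dom S X = {\<eta> \<in> closure S. \<exists>\<zeta>\<in>closure S. \<forall>\<xi>\<in>S. cinner (X \<xi>) \<eta> = cinner \<xi> \<zeta>}"

definition ess_self_adjoint :: "'a::chilbert set \<Rightarrow> ('a \<Rightarrow> 'a) set \<Rightarrow> bool" where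
  "ess_self_adjoint S N \<longleftrightarrow> (\<Inter>X\<in>N. closure_dom S X) = (\<Inter>X\<in>N. adj_dom S X)"

definition ess_sa_subspace :: "'a::chilbert set \<Rightarrow> ('a \<Rightarrow> 'a) set \<Rightarrow> 'a set \<Rightarrow> bool" where
  "ess_sa_subspace D N S \<longleftrightarrow> csubspace S \<and> S \<subseteq> D \<and> (\<forall>X\<in>N. X ` S \<subseteq> S)
     \<and> ess_self_adjoint S ((\<lambda>X. \<lambda>x. if x \<in> S then X x else 0) ` N)"

end

theory Submission
  imports Defs
begin

text \<open>The inclusion from right to left holds because \<open>E C E\<close> lies in the commutant \<open>\<MM>'\<close> for every
  \<open>C\<close> in the weak commutant of the reduced algebra. Conversely, let \<open>X\<close> belong to the bicommutant of
  the reduced algebra. Its only possible extension to \<open>S = \<langle>\<MM>' E \<D>\<rangle>\<close> is \<open>\<Sum>C \<xi> \<mapsto> \<Sum>C (X \<xi>)\<close>.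
  Since \<open>E \<D>\<close> is a Frechet space and \<open>X\<close> is adjointable, \<open>X\<close> is continuous for the graph topology;
  as \<open>X\<close> commutes with \<open>E \<MM>' E\<close>, the seminorm estimates transfer to \<open>S\<close>, so that the extension is
  well defined and continuous there. Essential self-adjointness shows that the projection \<open>Z\<close>
  onto the closure of \<open>S\<close> lies in \<open>\<MM>'\<close> and that \<open>S\<close> is graph-dense in \<open>Z \<D>\<close>, and completeness
  of \<open>\<D>\<close> extends \<open>X\<close> to \<open>\<xi> \<mapsto> X (Z \<xi>)\<close> on all of \<open>\<D>\<close>.\<close>

subsection \<open>Complex vector spaces\<close>

text \<open>A vector of \<open>S\<close> has many representations \<Sum>C \<xi>, and nothing bounds
  \<Sum>C (X \<xi>) term by term through the size of the whole sum. What can be compared are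
  compressions: for \<open>B\<close> in the commutant, E B C E commutes with X, hence E B applied to
  \<Sum>C (X \<xi>) equals X (E B \<Sum>C \<xi>). The norm must therefore be rebuilt from such
  corner components. Squared norms add up over components, so the bound is carried in squared form.
  If \<Sum>C \<xi> = 0, it forces \<Sum>C (X \<xi>) = 0; applied to Y X for each Y in the algebra,
  it gives convergence in the graph topology. The formal adjoint X' travels with X for three
  reasons: it yields continuity on E D, it makes limits unique by duality, and its own extension is
  the adjoint of the extended operator. Until uniqueness is known, the extension is only a relation
  between a vector and limits along lists.\<close>

lemma scaleC_zero_left [simp]: "0 *\<^sub>C x = (0::'a::complex_vector)"
  using scaleR_scaleC[of 0 x] by simp

lemma scaleC_minus_one: "(-1) *\<^sub>C x = - (x::'a::complex_vector)"
  using scaleR_scaleC[of "-1" x] by simp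

lemma scaleC_zero_right [simp]: "a *\<^sub>C 0 = (0::'a::complex_vector)"
  using scaleC_add_right[of a 0 "0::'a"] by simp

lemma csubspaceD:
  assumes "csubspace S"
  shows "0 \<in> S" "x \<in> S \<Longrightarrow> y \<in> S \<Longrightarrow> x + y \<in> S" "x \<in> S \<Longrightarrow> a *\<^sub>C x \<in> S"
    "x \<in> S \<Longrightarrow> - x \<in> S" "x \<in> S \<Longrightarrow> y \<in> S \<Longrightarrow> x - y \<in> S" "x \<in> S \<Longrightarrow> r *\<^sub>R x \<in> S"
proof -
  show "0 \<in> S" and add: "x \<in> S \<Longrightarrow> y \<in> S \<Longrightarrow> x + y \<in> S"
    and sc: "\<And>a x. x \<in> S \<Longrightarrow> a *\<^sub>C x \<in> S" for x y
    using assms by (auto simp: csubspace_def)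
  show neg: "- x \<in> S" if "x \<in> S" for x
    using sc[OF that, of "-1"] by (simp add: scaleC_minus_one)
  show "x - y \<in> S" if "x \<in> S" "y \<in> S"
    using add[OF that(1) neg[OF that(2)]] by simp
  show "x \<in> S \<Longrightarrow> r *\<^sub>R x \<in> S"
    using sc by (simp add: scaleR_scaleC)
qed

lemma csubspace_cspan: "csubspace (cspan S)"
  by (auto simp: cspan_def csubspace_def)

lemma cspan_superset: "S \<subseteq> cspan S"
  by (auto simp: cspan_def)

lemma cspan_minimal: "S \<subseteq> T \<Longrightarrow> csubspace T \<Longrightarrow> cspan S \<subseteq> T"
  by (auto simp: cspan_def)

subsection \<open>Inner products\<close>

lemma cinner_add_right: "cinner x (y + z) = cinner x y + cinner x (z::'a::complex_inner)"
  by (metis cinner_add_left cinner_commute complex_cnj_add)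

lemma cinner_scaleC_right: "cinner x (a *\<^sub>C y) = cnj a * cinner x (y::'a::complex_inner)"
  by (metis cinner_commute cinner_scaleC_left complex_cnj_mult)

lemma cinner_scaleR_left: "cinner (r *\<^sub>R x) y = r *\<^sub>R cinner x (y::'a::complex_inner)"
  by (simp add: scaleR_scaleC cinner_scaleC_left scaleR_conv_of_real)

lemma cinner_scaleR_right: "cinner x (r *\<^sub>R y) = r *\<^sub>R cinner x (y::'a::complex_inner)"
  by (simp add: scaleR_scaleC cinner_scaleC_right scaleR_conv_of_real)

lemma cinner_zero_left [simp]: "cinner 0 x = (0::complex)" for x :: "'a::complex_inner"
  using cinner_add_left[of 0 0 x] by simp

lemma cinner_zero_right [simp]: "cinner x 0 = (0::complex)" for x :: "'a::complex_inner"
  using cinner_add_right[of x 0 0] by simp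

lemma cinner_minus_left: "cinner (- x) y = - cinner x (y::'a::complex_inner)"
  using cinner_add_left[of x "-x" y] by (simp add: eq_neg_iff_add_eq_0 add.commute)

lemma cinner_minus_right: "cinner x (- y) = - cinner x (y::'a::complex_inner)"
  using cinner_add_right[of x y "-y"] by (simp add: eq_neg_iff_add_eq_0 add.commute)

lemma cinner_diff_left: "cinner (x - z) y = cinner x y - cinner z (y::'a::complex_inner)"
  using cinner_add_left[of x "-z" y] by (simp add: cinner_minus_left)

lemma cinner_diff_right: "cinner x (y - z) = cinner x y - cinner x (z::'a::complex_inner)"
  using cinner_add_right[of x y "-z"] by (simp add: cinner_minus_right)

lemma cinner_self: "cinner x x = complex_of_real ((norm x)\<^sup>2)" for x :: "'a::complex_inner"
proof (rule complex_eqI)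
  show "Re (cinner x x) = Re (complex_of_real ((norm x)\<^sup>2))"
    using cinner_nonneg[of x] by (simp add: norm_eq_sqrt_cinner)
  show "Im (cinner x x) = Im (complex_of_real ((norm x)\<^sup>2))"
    using arg_cong[OF cinner_commute[of x x], of Im] by simp
qed

text \<open>Pythagoras for the removal of the component along \<open>y\<close>. Cauchy-Schwarz and
  the orthogonality of a nearest point both follow from this computation.\<close>

lemma norm_diff_component:
  fixes x y :: "'a::complex_inner"
  assumes "y \<noteq> 0"
  shows "(norm (x - (cinner x y / cinner y y) *\<^sub>C y))\<^sup>2 = (norm x)\<^sup>2 - (cmod (cinner x y))\<^sup>2 / (norm y)\<^sup>2"
proof -
  let ?a = "cinner x y / cinner y y"
  have yy: "cinner y y \<noteq> 0" using assms by (simp add: cinner_eq_zero_iff)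
  have "complex_of_real ((norm (x - ?a *\<^sub>C y))\<^sup>2) = cinner (x - ?a *\<^sub>C y) (x - ?a *\<^sub>C y)"
    by (simp add: cinner_self)
  also have "\<dots> = cinner x x - cnj ?a * cinner x y - ?a * (cinner y x - cnj ?a * cinner y y)"
    by (simp add: cinner_diff_left cinner_diff_right cinner_scaleC_left cinner_scaleC_right algebra_simps)
  also have "cinner y x - cnj ?a * cinner y y = 0"
  proof -
    have "cnj ?a * cinner y y = cnj (?a * cinner y y)"
      by (simp add: cinner_commute[of y y, symmetric])
    also have "\<dots> = cinner y x" using yy by (simp add: cinner_commute[of y x])
    finally show ?thesis by simp
  qed
  also have "cnj ?a * cinner x y = complex_of_real ((cmod (cinner x y))\<^sup>2 / (norm y)\<^sup>2)"
    by (simp add: cinner_self complex_norm_square[symmetric] mult.commute flip: of_real_power)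
  finally show ?thesis
    unfolding cinner_self by (simp flip: of_real_diff add: of_real_eq_iff del: of_real_power of_real_divide)
qed

lemma cinner_Cauchy_Schwarz: "cmod (cinner x y) \<le> norm x * norm (y::'a::complex_inner)"
proof (cases "y = 0")
  case False
  have "0 \<le> (norm x)\<^sup>2 - (cmod (cinner x y))\<^sup>2 / (norm y)\<^sup>2"
    by (subst norm_diff_component[OF False, symmetric]) simp
  then have "(cmod (cinner x y))\<^sup>2 \<le> (norm x * norm y)\<^sup>2"
    using False by (simp add: field_simps power_mult_distrib)
  then show ?thesis by (rule power2_le_imp_le) simp
qed simp

lemma bounded_bilinear_cinner: "bounded_bilinear (cinner :: 'a::complex_inner \<Rightarrow> 'a \<Rightarrow> complex)"
proof
  show "\<exists>K. \<forall>a b :: 'a. cmod (cinner a b) \<le> norm a * norm b * K"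
    using cinner_Cauchy_Schwarz by (metis mult.right_neutral)
qed (simp_all add: cinner_add_left cinner_add_right cinner_scaleR_left cinner_scaleR_right)

lemmas tendsto_cinner = bounded_bilinear.tendsto[OF bounded_bilinear_cinner]

lemma norm_add_square:
  "(norm (x + y))\<^sup>2 = (norm x)\<^sup>2 + 2 * Re (cinner x y) + (norm (y::'a::complex_inner))\<^sup>2"
proof -
  have "Re (cinner (x + y) (x + y)) = Re (cinner x x) + Re (cinner x y) + Re (cinner y x) + Re (cinner y y)"
    by (simp add: cinner_add_left cinner_add_right)
  moreover have "Re (cinner y x) = Re (cinner x y)"
    by (subst cinner_commute) simp
  ultimately show ?thesis by (simp add: cinner_self flip: of_real_power)
qed

lemma norm_diff_square:
  "(norm (x - y))\<^sup>2 = (norm x)\<^sup>2 - 2 * Re (cinner x y) + (norm (y::'a::complex_inner))\<^sup>2"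
  using norm_add_square[of x "-y"] by (simp add: cinner_minus_right)

lemma norm_scaleC: "norm (a *\<^sub>C x) = cmod a * norm (x::'a::complex_inner)"
proof -
  have "complex_of_real ((norm (a *\<^sub>C x))\<^sup>2) = (a * cnj a) * cinner x x"
    by (simp only: cinner_self[symmetric] cinner_scaleC_left cinner_scaleC_right ac_simps)
  also have "\<dots> = complex_of_real ((cmod a * norm x)\<^sup>2)"
    by (simp add: cinner_self complex_norm_square[symmetric] power_mult_distrib)
  finally show ?thesis
    by (simp only: of_real_eq_iff) (simp add: power2_eq_iff_nonneg)
qed

lemma tendsto_scaleC: "(f \<longlongrightarrow> x) F \<Longrightarrow> ((\<lambda>n. a *\<^sub>C f n) \<longlongrightarrow> a *\<^sub>C (x::'a::complex_inner)) F"
proof -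
  have "bounded_linear (\<lambda>x::'a. a *\<^sub>C x)"
    by (rule bounded_linear_intro[where K = "cmod a"])
       (simp_all add: scaleC_add_right scaleR_scaleC scaleC_scaleC norm_scaleC mult.commute)
  then show "(f \<longlongrightarrow> x) F \<Longrightarrow> ?thesis" by (rule bounded_linear.tendsto)
qed

lemma csubspace_closure: "csubspace (S::'a::complex_inner set) \<Longrightarrow> csubspace (closure S)"
  unfolding csubspace_def
proof (intro conjI ballI allI; elim conjE)
  assume 0: "0 \<in> S" and add: "\<forall>x\<in>S. \<forall>y\<in>S. x + y \<in> S" and sc: "\<forall>a. \<forall>x\<in>S. a *\<^sub>C x \<in> S"
  show "0 \<in> closure S" using 0 closure_subset by blast
  fix x assume "x \<in> closure S"
  then obtain f where f: "\<And>n. f n \<in> S" "f \<longlonglongrightarrow> x" by (auto simp: closure_sequential)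
  show "a *\<^sub>C x \<in> closure S" for a
    unfolding closure_sequential using f(1) sc tendsto_scaleC[OF f(2), of a]
    by (intro exI[of _ "\<lambda>n. a *\<^sub>C f n"]) auto
  fix y assume "y \<in> closure S"
  then obtain g where g: "\<And>n. g n \<in> S" "g \<longlonglongrightarrow> y" by (auto simp: closure_sequential)
  show "x + y \<in> closure S"
    unfolding closure_sequential using f g add tendsto_add[OF f(2) g(2)]
    by (intro exI[of _ "\<lambda>n. f n + g n"]) auto
qed

lemma cinner_closure_eq_0:
  fixes S :: "'a::complex_inner set"
  assumes "\<And>s. s \<in> S \<Longrightarrow> cinner x s = 0" "y \<in> closure S"
  shows "cinner x y = 0"
proof -
  obtain f where f: "\<And>n. f n \<in> S" "f \<longlonglongrightarrow> y" using assms(2) by (auto simp: closure_sequential)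
  have "(\<lambda>n. cinner x (f n)) \<longlonglongrightarrow> cinner x y" by (intro tendsto_cinner tendsto_const f)
  then show ?thesis using f(1) assms(1) by (simp add: LIMSEQ_const_iff)
qed

lemma eq_0_if_orthogonal_dense:
  fixes S :: "'a::complex_inner set"
  assumes "\<And>s. s \<in> S \<Longrightarrow> cinner x s = 0" "x \<in> closure S"
  shows "x = 0"
  using cinner_closure_eq_0[OF assms] by (simp add: cinner_eq_zero_iff)

subsection \<open>Orthogonal projections and adjoints\<close>

instance chilbert \<subseteq> banach ..

lemma orthogonal_projection_exists:
  fixes K :: "'a::chilbert set"
  assumes K: "csubspace K" "closed K"
  shows "\<exists>p\<in>K. \<forall>k\<in>K. cinner (x - p) k = 0"
proof -
  note Ks = csubspaceD[OF K(1)]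
  define d where "d = Inf ((\<lambda>k. norm (x - k)) ` K)"
  have ne: "(\<lambda>k. norm (x - k)) ` K \<noteq> {}" using Ks(1) by blast
  have bdd: "bdd_below ((\<lambda>k. norm (x - k)) ` K)" by (rule bdd_belowI[of _ 0]) auto
  have d_le: "d \<le> norm (x - k)" if "k \<in> K" for k
    unfolding d_def using that by (intro cInf_lower bdd) auto
  have d0: "0 \<le> d" unfolding d_def using ne by (intro cInf_greatest) auto
  have "\<exists>k\<in>K. norm (x - k) < d + 1 / real (Suc n)" for n
  proof -
    have "d < d + 1 / real (Suc n)" by simp
    then show ?thesis using cInf_less_iff[OF ne bdd] unfolding d_def by blast
  qed
  then obtain k where k: "\<And>n. k n \<in> K" "\<And>n. norm (x - k n) < d + 1 / real (Suc n)" by metis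
  have lim: "(\<lambda>n. norm (x - k n)) \<longlonglongrightarrow> d"
  proof (rule tendsto_sandwich[OF _ _ tendsto_const])
    show "\<forall>\<^sub>F n in sequentially. d \<le> norm (x - k n)" using d_le k by auto
    show "\<forall>\<^sub>F n in sequentially. norm (x - k n) \<le> d + 1 / real (Suc n)"
      using k(2) by (intro always_eventually allI less_imp_le)
    show "(\<lambda>n. d + 1 / real (Suc n)) \<longlonglongrightarrow> d"
      using tendsto_add[OF tendsto_const[of d] LIMSEQ_inverse_real_of_nat]
      by (simp add: inverse_eq_divide)
  qed
  \<comment> \<open>The midpoint of \<open>k m\<close> and \<open>k n\<close> lies in
    \<open>K\<close>, so its distance from \<open>x\<close> is at least \<open>d\<close>; the
    parallelogram law then makes nearly minimal points close to each other.\<close>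
  have parallelogram: "(norm (k m - k n))\<^sup>2 \<le> 2 * (norm (x - k m))\<^sup>2 + 2 * (norm (x - k n))\<^sup>2 - 4 * d\<^sup>2" for m n
  proof -
    let ?u = "x - k m" and ?v = "x - k n"
    have "(norm (?u + ?v))\<^sup>2 + (norm (?u - ?v))\<^sup>2 = 2 * (norm ?u)\<^sup>2 + 2 * (norm ?v)\<^sup>2"
      unfolding norm_add_square[of ?u ?v] norm_diff_square[of ?u ?v] by simp
    moreover have "?u - ?v = - (k m - k n)" by simp
    moreover have "4 * d\<^sup>2 \<le> (norm (?u + ?v))\<^sup>2"
    proof -
      have "d \<le> norm (x - (1/2) *\<^sub>R (k m + k n))" by (intro d_le Ks k)
      then have "2 * d \<le> norm (2 *\<^sub>R (x - (1/2) *\<^sub>R (k m + k n)))" by simp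
      also have "2 *\<^sub>R (x - (1/2) *\<^sub>R (k m + k n)) = ?u + ?v"
        by (simp add: algebra_simps scaleR_2)
      finally have "(2 * d)\<^sup>2 \<le> (norm (?u + ?v))\<^sup>2" using d0 by (intro power_mono) auto
      then show ?thesis by (simp add: power_mult_distrib)
    qed
    ultimately show ?thesis by (simp only: norm_minus_cancel) 
  qed
  have "Cauchy k"
  proof (rule metric_CauchyI)
    fix e :: real assume "e > 0"
    have "(\<lambda>n. (norm (x - k n))\<^sup>2) \<longlonglongrightarrow> d\<^sup>2" by (intro tendsto_power lim)
    then have "\<forall>\<^sub>F n in sequentially. (norm (x - k n))\<^sup>2 < d\<^sup>2 + e\<^sup>2 / 4"
      using \<open>e > 0\<close> by (intro order_tendstoD(2)) auto
    then obtain N where N: "\<And>n. n \<ge> N \<Longrightarrow> (norm (x - k n))\<^sup>2 < d\<^sup>2 + e\<^sup>2 / 4"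
      by (auto simp: eventually_sequentially)
    show "\<exists>M. \<forall>m\<ge>M. \<forall>n\<ge>M. dist (k m) (k n) < e"
    proof (intro exI allI impI)
      fix m n assume "m \<ge> N" "n \<ge> N"
      then have "(norm (k m - k n))\<^sup>2 < e\<^sup>2" using parallelogram[of m n] N[of m] N[of n] by simp
      then show "dist (k m) (k n) < e"
        using \<open>e > 0\<close> unfolding dist_norm by (meson less_le power2_less_imp_less)
    qed
  qed
  then obtain p where p: "k \<longlonglongrightarrow> p" by (auto simp: Cauchy_convergent_iff convergent_def)
  have pK: "p \<in> K" using K(2) k(1) p by (auto intro: closed_sequentially)
  have "(\<lambda>n. norm (x - k n)) \<longlonglongrightarrow> norm (x - p)" by (intro tendsto_intros p)
  then have dp: "d = norm (x - p)" using lim LIMSEQ_unique by blast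
  have "cinner (x - p) y = 0" if "y \<in> K" for y
  proof (cases "y = 0")
    case False
    \<comment> \<open>If \<open>x - p\<close> had a component along \<open>y\<close>, moving
      \<open>p\<close> by it would stay in \<open>K\<close> and come closer to
      \<open>x\<close>.\<close>
    let ?a = "cinner (x - p) y / cinner y y"
    have "d \<le> norm (x - (p + ?a *\<^sub>C y))" by (intro d_le Ks pK that)
    then have "d\<^sup>2 \<le> (norm (x - p - ?a *\<^sub>C y))\<^sup>2"
      using d0 by (intro power_mono) (auto simp: algebra_simps)
    then have "(cmod (cinner (x - p) y))\<^sup>2 / (norm y)\<^sup>2 \<le> 0"
      using norm_diff_component[OF False, of "x - p"] dp by simp
    then show ?thesis using False by (simp add: divide_le_0_iff)
  qed simp
  then show ?thesis using pK by blast
qed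

lemma bounded_clinearD:
  assumes "bounded_clinear C"
  shows "C (x + y) = C x + C y" "C (a *\<^sub>C x) = a *\<^sub>C C x" "C 0 = 0" "C (- x) = - C x"
    "C (x - y) = C x - C y" "bounded_linear C"
proof -
  show add: "C (x + y) = C x + C y" and sc: "C (a *\<^sub>C x) = a *\<^sub>C C x" for a x y
    using assms by (auto simp: bounded_clinear_def)
  show bl: "bounded_linear C"
    using assms by (auto simp: bounded_clinear_def scaleR_scaleC intro!: bounded_linear_intro)
  show "C 0 = 0" "C (- x) = - C x" "C (x - y) = C x - C y"
    using bl by (auto simp: linear_simps)
qed

lemma bounded_clinear_comp:
  assumes "bounded_clinear A" "bounded_clinear B"
  shows "bounded_clinear (\<lambda>x. A (B x))"
  unfolding bounded_clinear_def
  using bounded_linear.bounded[OF bounded_linear_compose[OF bounded_clinearD(6)[OF assms(1)] bounded_clinearD(6)[OF assms(2)]]]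
  by (simp add: bounded_clinearD[OF assms(1)] bounded_clinearD[OF assms(2)])

lemma bounded_clinear_add:
  assumes "bounded_clinear A" "bounded_clinear B"
  shows "bounded_clinear (\<lambda>x. A x + B x)"
  unfolding bounded_clinear_def
  using bounded_linear.bounded[OF bounded_linear_add[OF bounded_clinearD(6)[OF assms(1)] bounded_clinearD(6)[OF assms(2)]]]
  by (simp add: bounded_clinearD[OF assms(1)] bounded_clinearD[OF assms(2)] scaleC_add_right)

lemma bounded_clinear_scaleC:
  assumes "bounded_clinear A"
  shows "bounded_clinear (\<lambda>x. a *\<^sub>C A x)"
proof -
  obtain K where "\<And>x. norm (A x) \<le> norm x * K" using assms by (auto simp: bounded_clinear_def)
  then have "norm (a *\<^sub>C A x) \<le> norm x * (cmod a * K)" for x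
    using mult_left_mono[of "norm (A x)" "norm x * K" "cmod a"] by (simp add: norm_scaleC ac_simps)
  then show ?thesis
    unfolding bounded_clinear_def
    by (auto simp: bounded_clinearD[OF assms] scaleC_add_right scaleC_scaleC mult.commute[of a]
        intro!: exI[of _ "cmod a * K"])
qed

lemma bounded_clinear_id: "bounded_clinear (\<lambda>x. x)"
  by (auto simp: bounded_clinear_def intro: exI[of _ 1])

lemma bounded_clinear_zero: "bounded_clinear (\<lambda>x. 0)"
  by (auto simp: bounded_clinear_def intro: exI[of _ 1])

text \<open>Riesz representation of the functional x \<mapsto> \<langle>C x, y\<rangle>: a suitable
  multiple of a vector orthogonal to its kernel represents it.\<close>

lemma adjoint_exists_pointwise:
  fixes C :: "'a::chilbert \<Rightarrow> 'a"
  assumes C: "bounded_clinear C"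
  shows "\<exists>z. \<forall>x. cinner (C x) y = cinner x z"
proof -
  note Cs = bounded_clinearD[OF C]
  define K where "K = {x. cinner (C x) y = 0}"
  have K: "csubspace K"
    by (auto simp: K_def csubspace_def Cs cinner_add_left cinner_scaleC_left)
  have "closed K"
    unfolding closed_sequential_limits
  proof (intro allI impI; elim conjE)
    fix f l assume f: "\<forall>n. f n \<in> K" "f \<longlonglongrightarrow> l"
    have "(\<lambda>n. cinner (C (f n)) y) \<longlonglongrightarrow> cinner (C l) y"
      by (intro tendsto_cinner tendsto_const bounded_linear.tendsto[OF Cs(6)] f(2))
    then show "l \<in> K" using f(1) by (simp add: K_def LIMSEQ_const_iff)
  qed
  show ?thesis
  proof (cases "K = UNIV")
    case True
    then show ?thesis by (intro exI[of _ 0]) (auto simp: K_def)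
  next
    case False
    then obtain x0 where x0: "x0 \<notin> K" by blast
    obtain p where p: "p \<in> K" "\<And>k. k \<in> K \<Longrightarrow> cinner (x0 - p) k = 0"
      using orthogonal_projection_exists[OF K \<open>closed K\<close>] by blast
    define u where "u = x0 - p"
    have fu: "cinner (C u) y \<noteq> 0"
      using x0 p(1) by (simp add: u_def K_def Cs cinner_diff_left)
    then have uu: "cinner u u \<noteq> 0"
      using Cs(3) by (metis cinner_eq_zero_iff cinner_zero_left)
    have "cinner (C x) y = cinner x (cnj (cinner (C u) y / cinner u u) *\<^sub>C u)" for x
    proof -
      let ?c = "cinner (C x) y / cinner (C u) y"
      have "x - ?c *\<^sub>C u \<in> K"
        using fu by (simp add: K_def Cs cinner_diff_left cinner_scaleC_left)
      then have "cinner u (x - ?c *\<^sub>C u) = 0" using p(2) by (simp add: u_def)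
      then have "cinner (x - ?c *\<^sub>C u) u = 0"
        by (subst cinner_commute) simp
      then have "cinner x u = ?c * cinner u u"
        by (simp add: cinner_diff_left cinner_scaleC_left)
      then show ?thesis using fu uu by (simp add: cinner_scaleC_right)
    qed
    then show ?thesis by blast
  qed
qed

lemma adjoint_exists:
  fixes C :: "'a::chilbert \<Rightarrow> 'a"
  assumes C: "bounded_clinear C"
  shows "\<exists>A. bounded_clinear A \<and> (\<forall>x y. cinner (C x) y = cinner x (A y))"
proof -
  obtain A where A: "\<And>x y. cinner (C x) y = cinner x (A y)"
    using adjoint_exists_pointwise[OF C] by metis
  have eqI: "u = v" if "\<And>x. cinner x u = cinner x v" for u v :: 'a
    using that[of "u - v"] by (metis cinner_diff_right cinner_eq_zero_iff right_minus_eq)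
  have add: "A (x + y) = A x + A y" for x y
    by (rule eqI) (simp add: cinner_add_right flip: A)
  have sc: "A (a *\<^sub>C x) = a *\<^sub>C A x" for a x
    by (rule eqI) (simp add: cinner_scaleC_right flip: A)
  obtain K where K: "\<And>x. norm (C x) \<le> norm x * K" using C by (auto simp: bounded_clinear_def)
  have "norm (A y) \<le> norm y * K" for y
  proof (cases "A y = 0")
    case True
    show ?thesis
    proof (cases "y = 0")
      case False
      \<comment> \<open>\<open>bounded_clinear\<close> puts no sign on \<open>K\<close>; a nonzero
        \<open>y\<close> supplies it.\<close>
      then have "0 \<le> K" using K[of y] norm_ge_zero[of "C y"]
        by (metis order_trans zero_le_mult_iff zero_less_norm_iff not_le)
      then show ?thesis using True by simp
    qed (use True in simp)
  next
    case False
    have "(norm (A y))\<^sup>2 = cmod (cinner (C (A y)) y)"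
      by (simp only: A cinner_self norm_of_real) simp
    also have "\<dots> \<le> norm (C (A y)) * norm y" by (rule cinner_Cauchy_Schwarz)
    also have "\<dots> \<le> norm (A y) * K * norm y" by (intro mult_right_mono K) simp
    finally show ?thesis using False by (simp add: power2_eq_square mult.assoc mult.commute[of K])
  qed
  then have "bounded_clinear A" using add sc by (auto simp: bounded_clinear_def)
  then show ?thesis using A by blast
qed

text \<open>The projection onto the closure of \<open>S\<close>. By continuity orthogonality need
  only be tested on \<open>S\<close> itself, which keeps \<open>cproj_unique\<close> easy to
  apply.\<close>

definition cproj :: "'a::chilbert set \<Rightarrow> 'a \<Rightarrow> 'a" where
  "cproj S x = (SOME p. p \<in> closure S \<and> (\<forall>s\<in>S. cinner (x - p) s = 0))"

lemma cproj:
  assumes "csubspace S"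
  shows "cproj S x \<in> closure S" "s \<in> closure S \<Longrightarrow> cinner (x - cproj S x) s = 0"
proof -
  have "\<exists>p. p \<in> closure S \<and> (\<forall>s\<in>S. cinner (x - p) s = 0)"
    using orthogonal_projection_exists[OF csubspace_closure[OF assms] closed_closure, of x] closure_subset by blast
  from someI_ex[OF this] have *: "cproj S x \<in> closure S" "\<And>s. s \<in> S \<Longrightarrow> cinner (x - cproj S x) s = 0"
    by (auto simp: cproj_def)
  show "cproj S x \<in> closure S" by (rule *)
  show "s \<in> closure S \<Longrightarrow> cinner (x - cproj S x) s = 0"
    using *(2) by (rule cinner_closure_eq_0)
qed

lemma cproj_unique:
  assumes S: "csubspace S" and p: "p \<in> closure S" "\<And>s. s \<in> S \<Longrightarrow> cinner (x - p) s = 0"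
  shows "cproj S x = p"
proof -
  note cl = csubspaceD[OF csubspace_closure[OF S]]
  have "cproj S x - p = 0"
  proof (rule eq_0_if_orthogonal_dense)
    show "cproj S x - p \<in> closure S" by (intro cl cproj(1)[OF S] p(1))
    fix s assume s: "s \<in> S"
    then have "s \<in> closure S" using closure_subset by blast
    then have "cinner (x - cproj S x) s = 0" using cproj(2)[OF S] by blast
    then show "cinner (cproj S x - p) s = 0" using p(2)[OF s] by (simp add: cinner_diff_left)
  qed
  then show ?thesis by simp
qed

lemma cproj_cinner:
  assumes "csubspace S" "s \<in> closure S"
  shows "cinner (cproj S x) s = cinner x s" "cinner s (cproj S x) = cinner s x"
proof -
  show *: "cinner (cproj S x) s = cinner x s"
    using cproj(2)[OF assms, of x] by (simp add: cinner_diff_left)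
  show "cinner s (cproj S x) = cinner s x"
    by (simp add: * cinner_commute[of s])
qed

lemma bounded_clinear_cproj:
  assumes S: "csubspace S"
  shows "bounded_clinear (cproj S)"
proof -
  note cl = csubspaceD[OF csubspace_closure[OF S]]
  have o: "cinner (cproj S x) s = cinner x s" if "s \<in> S" for x s
    using cproj_cinner(1)[OF S] that closure_subset by blast
  have "cproj S (x + y) = cproj S x + cproj S y" for x y
    by (rule cproj_unique[OF S cl(2)[OF cproj(1)[OF S] cproj(1)[OF S]]])
       (use o in \<open>simp add: cinner_diff_left cinner_add_left\<close>)
  moreover have "cproj S (a *\<^sub>C x) = a *\<^sub>C cproj S x" for a x
    by (rule cproj_unique[OF S cl(3)[OF cproj(1)[OF S]]])
       (use o in \<open>simp add: cinner_diff_left cinner_scaleC_left\<close>)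
  moreover have "norm (cproj S x) \<le> norm x * 1" for x
  proof (cases "cproj S x = 0")
    case False
    have "complex_of_real ((norm (cproj S x))\<^sup>2) = cinner x (cproj S x)"
      unfolding cinner_self[symmetric] by (rule cproj_cinner[OF S cproj(1)[OF S]])
    then have "(norm (cproj S x))\<^sup>2 = cmod (cinner x (cproj S x))"
      by (metis norm_of_real abs_of_nonneg zero_le_power2)
    then have "norm (cproj S x) * norm (cproj S x) \<le> norm x * norm (cproj S x)"
      using cinner_Cauchy_Schwarz by (metis power2_eq_square)
    then show ?thesis using False by simp
  qed simp
  ultimately show ?thesis unfolding bounded_clinear_def by blast
qed

subsection \<open>Automatic continuity of adjointable operators\<close>

definition clinear_on :: "'a::complex_vector set \<Rightarrow> ('a \<Rightarrow> 'a) \<Rightarrow> bool" where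
  "clinear_on V X \<longleftrightarrow> (\<forall>x\<in>V. \<forall>y\<in>V. X (x + y) = X x + X y) \<and> (\<forall>a. \<forall>x\<in>V. X (a *\<^sub>C x) = a *\<^sub>C X x)"

lemma clinear_onD:
  assumes "clinear_on V X" "csubspace V"
  shows "x \<in> V \<Longrightarrow> y \<in> V \<Longrightarrow> X (x + y) = X x + X y" "x \<in> V \<Longrightarrow> X (a *\<^sub>C x) = a *\<^sub>C X x"
    "X 0 = 0" "x \<in> V \<Longrightarrow> y \<in> V \<Longrightarrow> X (x - y) = X x - X y"
proof -
  show add: "x \<in> V \<Longrightarrow> y \<in> V \<Longrightarrow> X (x + y) = X x + X y"
    and sc: "\<And>a. x \<in> V \<Longrightarrow> X (a *\<^sub>C x) = a *\<^sub>C X x" for x y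
    using assms(1) by (auto simp: clinear_on_def)
  show "X 0 = 0" using sc[of 0 0] csubspaceD(1)[OF assms(2)] by simp
  show "X (x - y) = X x - X y" if "x \<in> V" "y \<in> V"
    using add[of x "(-1) *\<^sub>C y"] sc[of y "-1"] csubspaceD(3)[OF assms(2), of y "-1"] that
    by (simp add: scaleC_minus_one)
qed

text \<open>The bound starts at an index \<open>N\<close> because the gliding hump controls the
  seminorm k only from stage k on.\<close>

lemma Cauchy_if_geometric_increments:
  fixes f :: "nat \<Rightarrow> 'a::banach"
  assumes "\<And>n. n \<ge> N \<Longrightarrow> norm (f (Suc n) - f n) \<le> (1/2) ^ n"
  shows "Cauchy f"
proof -
  have "summable (\<lambda>n. f (Suc n) - f n)"
    using assms by (intro summable_comparison_test[OF _ summable_geometric[of "1/2::real"]]) auto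
  then have "convergent (\<lambda>n. f n - f 0)"
    by (simp add: summable_iff_convergent sum_lessThan_telescope)
  then have "convergent (\<lambda>n. f n - f 0 + f 0)"
    by (intro convergent_add convergent_const)
  then show ?thesis by (simp add: convergent_Cauchy)
qed

text \<open>Gliding hump: if \<open>X\<close> is unbounded, steps \<open>\<plusminus>\<xi>\<close> that are small in the seminorms but
  with \<open>X \<xi>\<close> large build a Cauchy sequence whose limit has \<open>norm (X x)\<close> arbitrarily large; the
  size of \<open>X\<close> at earlier stages is remembered by the continuous functionals \<open>x \<mapsto> \<langle>x, X' \<eta>\<rangle>\<close>.\<close>

lemma adjointable_seminorm_bound:
  fixes V :: "'a::chilbert set" and Ys :: "nat \<Rightarrow> 'a \<Rightarrow> 'a"
  assumes V: "csubspace V"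
    and Y: "\<And>k. clinear_on V (Ys k)"
    and Y0: "\<And>x. x \<in> V \<Longrightarrow> Ys 0 x = x"
    and complete: "\<And>f. (\<And>n. f n \<in> V) \<Longrightarrow> (\<And>k. Cauchy (\<lambda>n. Ys k (f n))) \<Longrightarrow> \<exists>x\<in>V. f \<longlonglongrightarrow> x"
    and X: "clinear_on V X" "\<And>x. x \<in> V \<Longrightarrow> X x \<in> V"
    and adj: "\<And>x y. x \<in> V \<Longrightarrow> y \<in> V \<Longrightarrow> cinner (X x) y = cinner x (X' y)"
  shows "\<exists>n c. 0 \<le> c \<and> (\<forall>x\<in>V. norm (X x) \<le> c * (\<Sum>k\<le>n. norm (Ys k x)))"
proof (rule ccontr)
  assume neg: "\<not> ?thesis"
  note Vs = csubspaceD[OF V] and Xl = clinear_onD[OF X(1) V] and Yl = clinear_onD[OF Y V]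
  \<comment> \<open>The number \<open>b\<close> dominates the norms of all vectors
    \<open>X' \<eta>\<close> chosen so far, so a step of size (1/2)^n / b hardly changes the
    remembered values \<langle>x, X' \<eta>\<rangle>, which then stay large in the limit.\<close>
  define hump where "hump n x b x' b' \<longleftrightarrow> b \<le> b' \<and>
    (\<Sum>k\<le>n. norm (Ys k (x' - x))) \<le> (1/2)^n / b \<and>
    (\<exists>\<eta>\<in>V. norm \<eta> \<le> 1 \<and> norm (X' \<eta>) \<le> b' \<and> real n \<le> cmod (cinner x' (X' \<eta>)))"
    for n :: nat and x x' :: 'a and b b' :: real
  have step: "\<exists>x'\<in>V. \<exists>b'. hump n x b x' b'" if x: "x \<in> V" and b: "1 \<le> b" for n x b
  proof -
    \<comment> \<open>Chosen so that scaling \<xi> to \<open>norm (X h) = real n\<close> makes the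
      seminorm sum of \<open>h\<close> at most (1/2)^n / b. For n = 0 the constant vanishes, hence
      the separate case below.\<close>
    define c where "c = real n * 2 ^ n * b"
    have c0: "0 \<le> c" using b by (simp add: c_def)
    then obtain \<xi> where \<xi>: "\<xi> \<in> V" "norm (X \<xi>) > c * (\<Sum>k\<le>n. norm (Ys k \<xi>))"
      using neg by (meson not_le)
    have p0: "0 \<le> (\<Sum>k\<le>n. norm (Ys k \<xi>))" by (intro sum_nonneg) simp
    then have X0: "norm (X \<xi>) > 0" using \<xi>(2) c0 by (meson mult_nonneg_nonneg order.strict_trans1)
    define s where "s = real n / norm (X \<xi>)"
    have s0: "0 \<le> s" by (simp add: s_def)
    define h where "h = complex_of_real s *\<^sub>C \<xi>"
    have h: "h \<in> V" unfolding h_def by (intro Vs \<xi>)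
    have Xh: "norm (X h) = real n"
      unfolding h_def using \<xi>(1) s0 X0 by (simp add: Xl norm_scaleC s_def norm_divide)
    have "norm (Ys k h) = s * norm (Ys k \<xi>)" for k
      unfolding h_def using \<xi>(1) s0 by (simp add: Yl norm_scaleC)
    then have "(\<Sum>k\<le>n. norm (Ys k h)) = s * (\<Sum>k\<le>n. norm (Ys k \<xi>))"
      by (simp add: sum_distrib_left)
    also have "\<dots> \<le> (1/2)^n / b"
    proof (cases "n = 0")
      case True
      then show ?thesis using b by (simp add: s_def)
    next
      case False
      then have cp: "c > 0" using b by (simp add: c_def)
      have "(\<Sum>k\<le>n. norm (Ys k \<xi>)) \<le> norm (X \<xi>) / c"
        using \<xi>(2) cp by (simp add: field_simps)
      then have "s * (\<Sum>k\<le>n. norm (Ys k \<xi>)) \<le> s * (norm (X \<xi>) / c)"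
        by (rule mult_left_mono[OF _ s0])
      also have "\<dots> = (1/2)^n / b"
        using X0 False b by (simp add: s_def c_def field_simps power_one_over)
      finally show ?thesis .
    qed
    finally have ph: "(\<Sum>k\<le>n. norm (Ys k h)) \<le> (1/2)^n / b" .
    have ph': "(\<Sum>k\<le>n. norm (Ys k (- h))) \<le> (1/2)^n / b"
    proof -
      have "Ys k (- h) = - Ys k h" for k
        using Yl(2)[OF h, of k "-1"] by (simp add: scaleC_minus_one)
      then show ?thesis using ph by simp
    qed
    \<comment> \<open>The images of \<open>x + h\<close> and \<open>x - h\<close> differ by 2 X h,
      so one of them has norm at least n, whatever \<open>X x\<close> is.\<close>
    obtain x' where x': "x' = x + h \<or> x' = x - h" "real n \<le> norm (X x')"
    proof -
      have "2 * norm (X h) = norm ((X x + X h) - (X x - X h))"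
        by (simp add: scaleR_2[symmetric])
      also have "\<dots> \<le> norm (X x + X h) + norm (X x - X h)" by (rule norm_triangle_ineq4)
      also have "\<dots> = norm (X (x + h)) + norm (X (x - h))" using x h by (simp add: Xl)
      finally have "real n \<le> norm (X (x + h)) \<or> real n \<le> norm (X (x - h))"
        unfolding Xh by linarith
      then show ?thesis using that by blast
    qed
    have x'V: "x' \<in> V" using x'(1) x h Vs(2,5) by blast
    \<comment> \<open>Normalising \<open>X x'\<close> turns its norm into the value of a continuous
      functional at \<open>x'\<close>. If \<open>X x' = 0\<close>, division by zero gives \<eta> =
      0, which still satisfies the claims.\<close>
    define \<eta> where "\<eta> = complex_of_real (1 / norm (X x')) *\<^sub>C X x'"
    have \<eta>V: "\<eta> \<in> V" unfolding \<eta>_def by (intro Vs X x'V)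
    have "norm \<eta> \<le> 1" by (simp add: \<eta>_def norm_scaleC norm_divide)
    moreover have "cinner x' (X' \<eta>) = complex_of_real (norm (X x'))"
      unfolding adj[OF x'V \<eta>V, symmetric]
      by (simp add: \<eta>_def cinner_scaleC_right cinner_self power2_eq_square)
    then have "real n \<le> cmod (cinner x' (X' \<eta>))" using x'(2) by simp
    moreover have "(\<Sum>k\<le>n. norm (Ys k (x' - x))) \<le> (1/2)^n / b" using x'(1) ph ph' by auto
    ultimately have "hump n x b x' (b + norm (X' \<eta>))"
      using \<eta>V b unfolding hump_def by (intro conjI bexI[of _ \<eta>]) auto
    then show ?thesis using x'V by blast
  qed
  have "\<exists>s. \<forall>n. (fst (s n) \<in> V \<and> 1 \<le> snd (s n)) \<and>
      hump n (fst (s n)) (snd (s n)) (fst (s (Suc n))) (snd (s (Suc n)))"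
  proof (rule dependent_nat_choice)
    show "\<exists>s. fst s \<in> V \<and> (1::real) \<le> snd s" using Vs(1) by (intro exI[of _ "(0, 1)"]) auto
    fix s :: "'a \<times> real" and n assume s: "fst s \<in> V \<and> 1 \<le> snd s"
    then obtain x' b' where "x' \<in> V" "hump n (fst s) (snd s) x' b'" using step by blast
    then show "\<exists>s'. (fst s' \<in> V \<and> 1 \<le> snd s') \<and> hump n (fst s) (snd s) (fst s') (snd s')"
      using s by (intro exI[of _ "(x', b')"]) (auto simp: hump_def)
  qed
  then obtain s where s: "\<And>n. fst (s n) \<in> V" "\<And>n. 1 \<le> snd (s n)"
      "\<And>n. hump n (fst (s n)) (snd (s n)) (fst (s (Suc n))) (snd (s (Suc n)))" by blast
  define x where "x n = fst (s n)" for n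
  define b where "b n = snd (s n)" for n
  have xV: "x n \<in> V" and b1: "1 \<le> b n" and hump: "hump n (x n) (b n) (x (Suc n)) (b (Suc n))" for n
    using s by (auto simp: x_def b_def)
  have inc: "norm (Ys k (x (Suc n) - x n)) \<le> (1/2)^n / b n" if "k \<le> n" for k n
  proof -
    have "norm (Ys k (x (Suc n) - x n)) \<le> (\<Sum>k\<le>n. norm (Ys k (x (Suc n) - x n)))"
      using that by (intro member_le_sum) auto
    then show ?thesis using hump[of n] by (auto simp: hump_def)
  qed
  have "Cauchy (\<lambda>n. Ys k (x n))" for k
  proof (rule Cauchy_if_geometric_increments[where N = k])
    fix n assume "k \<le> n"
    have "norm (Ys k (x (Suc n) - x n)) \<le> (1/2)^n / b n" by (rule inc[OF \<open>k \<le> n\<close>])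
    also have "\<dots> \<le> (1/2)^n / 1" using b1[of n] by (intro divide_left_mono) auto
    finally show "norm (Ys k (x (Suc n)) - Ys k (x n)) \<le> (1/2)^n" using xV by (simp add: Yl)
  qed
  then obtain l where l: "l \<in> V" "x \<longlonglongrightarrow> l" using complete[of x] xV by blast
  have bmono: "b m \<le> b n" if "m \<le> n" for m n
    by (rule lift_Suc_mono_le[OF _ that]) (use hump in \<open>simp add: hump_def\<close>)
  have tail: "norm (x (m + j) - x m) \<le> (2 * (1/2)^m - 2 * (1/2)^(m+j)) / b m" for m j
  proof (induction j)
    case (Suc j)
    have "norm (x (Suc (m + j)) - x (m + j)) \<le> (1/2)^(m+j) / b (m+j)"
      using inc[of 0 "m + j"] Y0 Vs(5)[OF xV xV] by simp
    also have "\<dots> \<le> (1/2)^(m+j) / b m"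
      using b1[of m] bmono[of m "m+j"] by (intro divide_left_mono) auto
    finally have "norm (x (Suc (m + j)) - x m) \<le> (1/2)^(m+j) / b m + (2 * (1/2)^m - 2 * (1/2)^(m+j)) / b m"
      using Suc norm_triangle_ineq[of "x (Suc (m + j)) - x (m + j)" "x (m + j) - x m"] by simp
    then show ?case by (simp add: add_divide_distrib[symmetric])
  qed simp
  \<comment> \<open>The functional found at stage m belongs to \<open>x (Suc m)\<close> and has norm
    at most \<open>b (Suc m)\<close>; from that index on the geometric factor 2 (1/2)^(Suc m) is at
    most 1.\<close>
  have tail': "norm (l - x (Suc m)) \<le> 1 / b (Suc m)" for m
  proof (rule LIMSEQ_le_const2)
    show "(\<lambda>j. norm (x (j + Suc m) - x (Suc m))) \<longlonglongrightarrow> norm (l - x (Suc m))"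
      by (intro tendsto_intros LIMSEQ_ignore_initial_segment l)
    have "norm (x (j + Suc m) - x (Suc m)) \<le> 1 / b (Suc m)" for j
    proof -
      have "(1/2)^m \<le> (1::real)" and "0 \<le> (1/2::real)^(m + j)" by (simp_all add: power_le_one)
      then have "2 * (1/2)^(Suc m) - 2 * (1/2)^(Suc m + j) \<le> (1::real)"
        unfolding power_Suc add_Suc by linarith
      then have "(2 * (1/2)^(Suc m) - 2 * (1/2)^(Suc m + j)) / b (Suc m) \<le> 1 / b (Suc m)"
        using b1[of "Suc m"] by (intro divide_right_mono) auto
      then show ?thesis using tail[of "Suc m" j] by (simp only: add.commute)
    qed
    then show "\<exists>N. \<forall>j\<ge>N. norm (x (j + Suc m) - x (Suc m)) \<le> 1 / b (Suc m)" by blast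
  qed
  have "real n \<le> norm (X l) + 1" for n
  proof -
    obtain \<eta> where \<eta>: "\<eta> \<in> V" "norm \<eta> \<le> 1" "norm (X' \<eta>) \<le> b (Suc n)" "real n \<le> cmod (cinner (x (Suc n)) (X' \<eta>))"
      using hump[of n] by (auto simp: hump_def)
    have "cinner (x (Suc n)) (X' \<eta>) = cinner l (X' \<eta>) - cinner (l - x (Suc n)) (X' \<eta>)"
      by (simp add: cinner_diff_left)
    then have "real n \<le> cmod (cinner l (X' \<eta>)) + cmod (cinner (l - x (Suc n)) (X' \<eta>))"
      using \<eta>(4) norm_triangle_ineq4 order_trans by metis
    moreover have "cmod (cinner l (X' \<eta>)) \<le> norm (X l)"
    proof -
      have "cmod (cinner l (X' \<eta>)) \<le> norm (X l) * norm \<eta>"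
        using cinner_Cauchy_Schwarz[of "X l" \<eta>] adj[OF l(1) \<eta>(1)] by simp
      also have "\<dots> \<le> norm (X l) * 1" using \<eta>(2) by (intro mult_left_mono) auto
      finally show ?thesis by simp
    qed
    moreover have "cmod (cinner (l - x (Suc n)) (X' \<eta>)) \<le> 1"
    proof -
      have "cmod (cinner (l - x (Suc n)) (X' \<eta>)) \<le> norm (l - x (Suc n)) * norm (X' \<eta>)"
        by (rule cinner_Cauchy_Schwarz)
      also have "\<dots> \<le> 1 / b (Suc n) * b (Suc n)"
        using b1[of "Suc n"] by (intro mult_mono tail' \<eta>) auto
      finally show ?thesis using b1[of "Suc n"] by simp
    qed
    ultimately show ?thesis by linarith
  qed
  then show False by (metis reals_Archimedean2 not_le)
qed

subsection \<open>The weak commutant\<close>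

lemma LdagD:
  assumes "X \<in> Ldag K D"
  shows "clinear_on D X" "x \<in> D \<Longrightarrow> X x \<in> D" "x \<notin> D \<Longrightarrow> X x = 0"
  using assms by (auto simp: Ldag_def clinear_on_def)

text \<open>Two candidates differ by a vector of \<open>D\<close>, so the difference can be tested
  against itself.\<close>

lemma dagger_eqI:
  assumes D: "csubspace D" and z: "y \<in> D" "z \<in> D" "\<And>x. x \<in> D \<Longrightarrow> cinner (X x) y = cinner x z"
  shows "dagger D X y = z"
proof -
  have "(THE z. z \<in> D \<and> (\<forall>x\<in>D. cinner (X x) y = cinner x z)) = z"
  proof (rule the_equality)
    fix w assume w: "w \<in> D \<and> (\<forall>x\<in>D. cinner (X x) y = cinner x w)"
    then have "w - z \<in> D" using csubspaceD(5)[OF D] z(2) by blast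
    then have "cinner (w - z) w = cinner (w - z) z" using w z(3) by metis
    then have "cinner (w - z) (w - z) = 0" by (simp add: cinner_diff_right)
    then show "w = z" by (simp add: cinner_eq_zero_iff)
  qed (use z in blast)
  then show ?thesis using z(1) by (simp add: dagger_def)
qed

lemma dagger:
  assumes D: "csubspace D" and X: "X \<in> Ldag K D" and y: "y \<in> D"
  shows "dagger D X y \<in> D" "x \<in> D \<Longrightarrow> cinner (X x) y = cinner x (dagger D X y)"
proof -
  have "\<exists>z\<in>D. \<forall>x\<in>D. cinner (X x) y = cinner x z"
    using X y by (simp add: Ldag_def)
  then obtain z where z: "z \<in> D" "\<And>x. x \<in> D \<Longrightarrow> cinner (X x) y = cinner x z" by blast
  have "dagger D X y = z" by (rule dagger_eqI[OF D y z])
  then show "dagger D X y \<in> D" "x \<in> D \<Longrightarrow> cinner (X x) y = cinner x (dagger D X y)"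
    using z by auto
qed

locale invariant_commutant =
  fixes D :: "'h::chilbert set" and M :: "('h \<Rightarrow> 'h) set"
  assumes dom: "dense_domain UNIV D"
    and closed_alg: "closed_Oalg UNIV D M"
    and frechet: "frechet_domain D M"
    and invariant: "\<forall>C\<in>wcomm UNIV D M. C ` D \<subseteq> D"
begin

abbreviation comm :: "('h \<Rightarrow> 'h) set" where "comm \<equiv> wcomm UNIV D M"
abbreviation bicomm :: "('h \<Rightarrow> 'h) set" where "bicomm \<equiv> wcc UNIV D M"

lemma csubspace_D: "csubspace D"
  using dom by (simp add: dense_domain_def)

lemma eq_if_cinner_eq_on_D:
  assumes "\<And>\<eta>. \<eta> \<in> D \<Longrightarrow> cinner u \<eta> = cinner v \<eta>"
  shows "u = v"
proof -
  have "u - v = 0"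
    using dom assms by (intro eq_0_if_orthogonal_dense[where S = D])
      (auto simp: dense_domain_def cinner_diff_left)
  then show ?thesis by simp
qed

lemma alg_Ldag: "X \<in> M \<Longrightarrow> X \<in> Ldag UNIV D"
  and alg_id: "idD D \<in> M"
  and alg_add: "X \<in> M \<Longrightarrow> Y \<in> M \<Longrightarrow> (\<lambda>x. X x + Y x) \<in> M"
  and alg_comp: "X \<in> M \<Longrightarrow> Y \<in> M \<Longrightarrow> X \<circ> Y \<in> M"
  and alg_dagger: "X \<in> M \<Longrightarrow> dagger D X \<in> M"
  using closed_alg unfolding closed_Oalg_def Oalg_def by blast+

lemma bicomm_Ldag: "X \<in> bicomm \<Longrightarrow> X \<in> Ldag UNIV D"
  by (simp add: wcc_def)

lemma alg_subset_bicomm: "X \<in> M \<Longrightarrow> X \<in> bicomm"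
  using alg_Ldag by (auto simp: wcc_def wcomm_def)

lemma comm_bounded: "C \<in> comm \<Longrightarrow> bounded_clinear C"
  by (simp add: wcomm_def)

lemma comm_D: "C \<in> comm \<Longrightarrow> \<xi> \<in> D \<Longrightarrow> C \<xi> \<in> D"
  using invariant by blast

text \<open>Weak commutation becomes genuine commutation because \<open>C \<xi>\<close> stays in
  \<open>D\<close>, so that the adjoint can be moved back onto it. This is the use of the invariance
  of \<open>D\<close>.\<close>

lemma comm_commute:
  assumes C: "C \<in> comm" and X: "X \<in> bicomm" and \<xi>: "\<xi> \<in> D"
  shows "C (X \<xi>) = X (C \<xi>)"
proof (rule eq_if_cinner_eq_on_D)
  fix \<eta> assume \<eta>: "\<eta> \<in> D"
  have "cinner (C (X \<xi>)) \<eta> = cinner (C \<xi>) (dagger D X \<eta>)"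
    using C X \<xi> \<eta> by (auto simp: wcc_def)
  also have "\<dots> = cinner (X (C \<xi>)) \<eta>"
    using dagger(2)[OF csubspace_D bicomm_Ldag[OF X] \<eta> comm_D[OF C \<xi>]] by simp
  finally show "cinner (C (X \<xi>)) \<eta> = cinner (X (C \<xi>)) \<eta>" .
qed

lemma commI:
  assumes "bounded_clinear C" "\<And>\<xi>. \<xi> \<in> D \<Longrightarrow> C \<xi> \<in> D"
    "\<And>X \<xi>. X \<in> M \<Longrightarrow> \<xi> \<in> D \<Longrightarrow> C (X \<xi>) = X (C \<xi>)"
  shows "C \<in> comm"
  using assms dagger(2)[OF csubspace_D alg_Ldag] by (auto simp: wcomm_def)

lemma comm_alg_commute: "C \<in> comm \<Longrightarrow> X \<in> M \<Longrightarrow> \<xi> \<in> D \<Longrightarrow> C (X \<xi>) = X (C \<xi>)"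
  by (rule comm_commute[OF _ alg_subset_bicomm])

lemma comm_id: "(\<lambda>x. x) \<in> comm"
  by (rule commI) (auto simp: bounded_clinear_id)

lemma comm_zero: "(\<lambda>x. 0) \<in> comm"
  using clinear_onD(3)[OF LdagD(1)[OF alg_Ldag] csubspace_D] csubspaceD(1)[OF csubspace_D]
  by (intro commI) (auto simp: bounded_clinear_zero)

lemma comm_comp: "A \<in> comm \<Longrightarrow> B \<in> comm \<Longrightarrow> (\<lambda>x. A (B x)) \<in> comm"
  by (rule commI) (simp_all add: bounded_clinear_comp comm_bounded comm_D comm_alg_commute)

lemma comm_scaleC: "A \<in> comm \<Longrightarrow> (\<lambda>x. a *\<^sub>C A x) \<in> comm"
  by (rule commI) (simp_all add: bounded_clinear_scaleC comm_bounded comm_D comm_alg_commute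
      csubspaceD[OF csubspace_D] clinear_onD(2)[OF LdagD(1)[OF alg_Ldag] csubspace_D])

lemma comm_add: "A \<in> comm \<Longrightarrow> B \<in> comm \<Longrightarrow> (\<lambda>x. A x + B x) \<in> comm"
  by (rule commI) (simp_all add: bounded_clinear_add comm_bounded comm_D comm_alg_commute
      csubspaceD[OF csubspace_D] clinear_onD(1)[OF LdagD(1)[OF alg_Ldag] csubspace_D])

lemma comm_funpow: "A \<in> comm \<Longrightarrow> (A ^^ n) \<in> comm"
proof (induction n)
  case 0
  show ?case using comm_id by (simp add: id_def)
next
  case (Suc n)
  then show ?case using comm_comp[of A "A ^^ n"] by (simp add: comp_def)
qed

definition adj :: "('h \<Rightarrow> 'h) \<Rightarrow> 'h \<Rightarrow> 'h" where
  "adj C = (SOME A. bounded_clinear A \<and> (\<forall>x y. cinner (C x) y = cinner x (A y)))"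

lemma adj:
  assumes C: "C \<in> comm"
  shows "cinner (C x) y = cinner x (adj C y)" "cinner (adj C x) y = cinner x (C y)" "adj C \<in> comm"
proof -
  have "bounded_clinear (adj C) \<and> (\<forall>x y. cinner (C x) y = cinner x (adj C y))"
    unfolding adj_def by (rule someI_ex[OF adjoint_exists[OF comm_bounded[OF C]]])
  then have *: "bounded_clinear (adj C)" "\<And>x y. cinner (C x) y = cinner x (adj C y)" by blast+
  show "cinner (C x) y = cinner x (adj C y)" by (rule *)
  show **: "cinner (adj C x) y = cinner x (C y)" for x y
    unfolding cinner_commute[of "adj C x"] cinner_commute[of x] by (simp add: *(2))
  have "cinner (adj C (X \<xi>)) \<eta> = cinner (adj C \<xi>) (dagger D X \<eta>)" if "X \<in> M" "\<xi> \<in> D" "\<eta> \<in> D" for X \<xi> \<eta>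
  proof -
    have "cinner (adj C (X \<xi>)) \<eta> = cinner \<xi> (dagger D X (C \<eta>))"
      using dagger(2)[OF csubspace_D alg_Ldag, of X "C \<eta>" \<xi>] that comm_D[OF C] by (simp add: **)
    \<comment> \<open>The algebra is closed under the involution, so \<open>C\<close> commutes with
      \<open>dagger D X\<close>; dualising gives the relation of \<open>adj C\<close> with
      \<open>X\<close>.\<close>
    also have "dagger D X (C \<eta>) = C (dagger D X \<eta>)"
      using comm_alg_commute[OF C alg_dagger] that by simp
    finally show ?thesis by (simp add: **)
  qed
  then show "adj C \<in> comm" using *(1) by (auto simp: wcomm_def)
qed

section \<open>Sequential form of the Frechet assumptions\<close>

lemma graph_complete_sequence:
  assumes f: "\<And>n. f n \<in> D" "\<And>X. X \<in> M \<Longrightarrow> Cauchy (\<lambda>n::nat. X (f n))"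
  shows "\<exists>\<xi>\<in>D. \<forall>X\<in>M. (\<lambda>n. X (f n)) \<longlonglongrightarrow> X \<xi>"
proof -
  let ?F = "filtermap f sequentially"
  have "?F \<noteq> bot" by (simp add: filtermap_bot_iff)
  moreover have "eventually (\<lambda>x. x \<in> D) ?F" using f(1) by (simp add: eventually_filtermap)
  moreover have "\<forall>\<^sub>F (x, y) in ?F \<times>\<^sub>F ?F. norm (X x - X y) < e" if X: "X \<in> M" and e: "e > 0" for X e
  proof -
    obtain n0 where n0: "\<And>m n. m \<ge> n0 \<Longrightarrow> n \<ge> n0 \<Longrightarrow> norm (X (f m) - X (f n)) < e"
      using CauchyD[OF f(2)[OF X] e] by blast
    show ?thesis
      unfolding eventually_prod_filter
      by (rule exI[of _ "\<lambda>x. \<exists>n\<ge>n0. x = f n"], rule exI[of _ "\<lambda>x. \<exists>n\<ge>n0. x = f n"])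
         (use n0 in \<open>auto simp: eventually_filtermap eventually_sequentially\<close>)
  qed
  ultimately obtain \<xi> where \<xi>: "\<xi> \<in> D"
      "\<And>X e. X \<in> M \<Longrightarrow> e > 0 \<Longrightarrow> eventually (\<lambda>x. norm (X x - X \<xi>) < e) ?F"
    using frechet[unfolded frechet_domain_def graph_complete_def, THEN conjunct1, rule_format, of ?F]
    by blast
  have "(\<lambda>n. X (f n)) \<longlonglongrightarrow> X \<xi>" if "X \<in> M" for X
    using \<xi>(2)[OF that] by (auto intro!: tendstoI simp: dist_norm eventually_filtermap)
  then show ?thesis using \<xi>(1) by blast
qed

text \<open>Prepending the identity puts the Hilbert norm among the seminorms, so that graph
  convergence includes norm convergence. The shift by one explains the index \<open>Suc n\<close>,
  and \<open>\<bar>c\<bar>\<close> makes the constant nonnegative.\<close>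

lemma graph_metrizable_from_identity:
  obtains Ys :: "nat \<Rightarrow> 'h \<Rightarrow> 'h" where "range Ys \<subseteq> M" "Ys 0 = idD D"
    "\<And>X. X \<in> M \<Longrightarrow> \<exists>n c. 0 \<le> c \<and> (\<forall>\<xi>\<in>D. norm (X \<xi>) \<le> c * (\<Sum>k\<le>n. norm (Ys k \<xi>)))"
proof -
  from frechet[unfolded frechet_domain_def graph_metrizable_def, THEN conjunct2]
  obtain Xs :: "nat \<Rightarrow> 'h \<Rightarrow> 'h" where *: "range Xs \<subseteq> M \<and>
      (\<forall>X\<in>M. \<exists>n c. \<forall>\<xi>\<in>D. norm (X \<xi>) \<le> c * (\<Sum>k\<le>n. norm (Xs k \<xi>)))" ..
  note Xs = conjunct1[OF *] bspec[OF conjunct2[OF *]]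
  define Ys where "Ys k = (case k of 0 \<Rightarrow> idD D | Suc j \<Rightarrow> Xs j)" for k
  show thesis
  proof
    show "range Ys \<subseteq> M" using Xs(1) alg_id by (auto simp: Ys_def image_subset_iff split: nat.split)
    show "Ys 0 = idD D" by (simp add: Ys_def)
    fix X assume "X \<in> M"
    then obtain n c where c: "\<And>\<xi>. \<xi> \<in> D \<Longrightarrow> norm (X \<xi>) \<le> c * (\<Sum>k\<le>n. norm (Xs k \<xi>))"
      using Xs(2) by blast
    have "norm (X \<xi>) \<le> \<bar>c\<bar> * (\<Sum>k\<le>Suc n. norm (Ys k \<xi>))" if "\<xi> \<in> D" for \<xi>
    proof -
      have "(\<Sum>k\<le>n. norm (Xs k \<xi>)) \<le> (\<Sum>k\<le>Suc n. norm (Ys k \<xi>))"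
        unfolding sum.atMost_Suc_shift by (simp add: Ys_def)
      moreover have "0 \<le> (\<Sum>k\<le>n. norm (Xs k \<xi>))" by (intro sum_nonneg) simp
      ultimately have "c * (\<Sum>k\<le>n. norm (Xs k \<xi>)) \<le> \<bar>c\<bar> * (\<Sum>k\<le>Suc n. norm (Ys k \<xi>))"
        by (intro mult_mono) auto
      then show ?thesis using c[OF that] by linarith
    qed
    then show "\<exists>n c. 0 \<le> c \<and> (\<forall>\<xi>\<in>D. norm (X \<xi>) \<le> c * (\<Sum>k\<le>n. norm (Ys k \<xi>)))"
      by (intro exI[of _ "Suc n"] exI[of _ "\<bar>c\<bar>"]) simp
  qed
qed

end

subsection \<open>Operators on the corner and the key estimate\<close>

locale reduction = invariant_commutant D M for D :: "'h::chilbert set" and M +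
  fixes E :: "'h \<Rightarrow> 'h"
  assumes projection: "is_projection E" and E_comm: "E \<in> comm"
begin

definition V :: "'h set" where "V = E ` D"

lemma E_bounded: "bounded_clinear E" and E_idem: "E (E x) = E x"
  and E_cinner: "cinner (E x) y = cinner x (E y)"
  using projection by (auto simp: is_projection_def)

lemmas E_linear = bounded_clinearD[OF E_bounded]

lemma V_iff: "v \<in> V \<longleftrightarrow> v \<in> D \<and> E v = v"
  unfolding V_def using comm_D[OF E_comm] by (metis E_idem imageE imageI)

lemma V_I: "x \<in> D \<Longrightarrow> E x \<in> V"
  unfolding V_def by (rule imageI)

lemma csubspace_V: "csubspace V"
  using csubspaceD[OF csubspace_D] by (auto simp: csubspace_def V_iff E_linear)

text \<open>The family \<open>L\<close> of pairs \<open>(C, \<xi>)\<close> encodes the vector \<open>\<Sum>C \<xi>\<close>, and \<open>val X L\<close> is the image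
  \<open>\<Sum>C (X \<xi>)\<close> of this vector under the prospective extension of \<open>X\<close>.\<close>

definition valid :: "(('h \<Rightarrow> 'h) \<times> 'h) list \<Rightarrow> bool" where
  "valid L \<longleftrightarrow> (\<forall>(C, \<xi>)\<in>set L. C \<in> comm \<and> \<xi> \<in> V)"

definition val :: "('h \<Rightarrow> 'h) \<Rightarrow> (('h \<Rightarrow> 'h) \<times> 'h) list \<Rightarrow> 'h" where
  "val X L = (\<Sum>(C, \<xi>)\<leftarrow>L. C (X \<xi>))"

text \<open>Since E \<zeta> = \<zeta> on \<open>V\<close>, the last clause is commutation with the
  compressions E C E. These belong to the weak commutant of the reduced algebra, so the clause is
  the strong form of the bicommutant condition.\<close>

definition corner_op :: "('h \<Rightarrow> 'h) \<Rightarrow> bool" where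
  "corner_op X \<longleftrightarrow> clinear_on V X \<and> (\<forall>\<zeta>\<in>V. X \<zeta> \<in> V) \<and> (\<forall>C\<in>comm. \<forall>\<zeta>\<in>V. E (C (X \<zeta>)) = X (E (C \<zeta>)))"

lemma corner_opD:
  assumes "corner_op X"
  shows "clinear_on V X" "\<zeta> \<in> V \<Longrightarrow> X \<zeta> \<in> V" "C \<in> comm \<Longrightarrow> \<zeta> \<in> V \<Longrightarrow> E (C (X \<zeta>)) = X (E (C \<zeta>))"
  using assms by (auto simp: corner_op_def)

lemma corner_op_id: "corner_op (\<lambda>x. x)"
  by (auto simp: corner_op_def clinear_on_def)

lemma val_Nil [simp]: "val X [] = 0"
  and val_Cons [simp]: "val X ((C, \<xi>) # L) = C (X \<xi>) + val X L"
  and valid_Nil [simp]: "valid []"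
  and valid_Cons [simp]: "valid ((C, \<xi>) # L) \<longleftrightarrow> C \<in> comm \<and> \<xi> \<in> V \<and> valid L"
  by (auto simp: val_def valid_def)

lemma val_append: "val X (L @ L') = val X L + val X L'"
  by (simp add: val_def)

lemma valid_append: "valid (L @ L') \<longleftrightarrow> valid L \<and> valid L'"
  by (simp add: valid_def ball_Un)

definition left_mult :: "('h \<Rightarrow> 'h) \<Rightarrow> (('h \<Rightarrow> 'h) \<times> 'h) list \<Rightarrow> (('h \<Rightarrow> 'h) \<times> 'h) list" where
  "left_mult B = map (\<lambda>(C, \<xi>). (\<lambda>x. B (C x), \<xi>))"

lemma val_left_mult: "bounded_clinear B \<Longrightarrow> val X (left_mult B L) = B (val X L)"
  by (induction L) (auto simp: left_mult_def bounded_clinearD)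

lemma valid_left_mult: "B \<in> comm \<Longrightarrow> valid L \<Longrightarrow> valid (left_mult B L)"
  by (induction L) (auto simp: left_mult_def comm_comp)

lemma val_in_D:
  assumes "corner_op X"
  shows "valid L \<Longrightarrow> val X L \<in> D"
proof (induction L)
  case (Cons p L)
  then show ?case
    using corner_opD(2)[OF assms] comm_D csubspaceD(2)[OF csubspace_D] by (cases p) (auto simp: V_iff)
qed (simp add: csubspaceD[OF csubspace_D])

lemma bicomm_val:
  assumes Y: "Y \<in> bicomm" and X: "corner_op X"
  shows "valid L \<Longrightarrow> Y (val X L) = val (\<lambda>x. Y (X x)) L"
proof (induction L)
  case Nil
  show ?case using clinear_onD(3)[OF LdagD(1)[OF bicomm_Ldag[OF Y]] csubspace_D] by simp
next
  case (Cons p L)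
  obtain C \<xi> where p: "p = (C, \<xi>)" by (cases p)
  have *: "C \<in> comm" "X \<xi> \<in> D" "valid L"
    using Cons.prems corner_opD(2)[OF X] by (auto simp: p V_iff)
  have "Y (C (X \<xi>) + val X L) = Y (C (X \<xi>)) + Y (val X L)"
    by (rule clinear_onD(1)[OF LdagD(1)[OF bicomm_Ldag[OF Y]] csubspace_D comm_D[OF *(1,2)] val_in_D[OF X *(3)]])
  then show ?case using Cons.IH[OF *(3)] comm_commute[OF *(1) Y *(2)] by (simp add: p)
qed

lemma corner_op_comp: "corner_op A \<Longrightarrow> corner_op B \<Longrightarrow> corner_op (\<lambda>x. A (B x))"
  by (simp add: corner_op_def clinear_on_def)

lemma bicomm_V: "Y \<in> bicomm \<Longrightarrow> v \<in> V \<Longrightarrow> Y v \<in> V"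
  using comm_commute[OF E_comm, of Y v] LdagD(2)[OF bicomm_Ldag, of Y v] by (simp add: V_iff)

lemma corner_op_bicomm:
  assumes Y: "Y \<in> bicomm"
  shows "corner_op Y"
proof -
  note Yl = clinear_onD[OF LdagD(1)[OF bicomm_Ldag[OF Y]] csubspace_D]
  have "clinear_on V Y" using Yl by (simp add: clinear_on_def V_iff)
  moreover have "E (C (Y \<zeta>)) = Y (E (C \<zeta>))" if "C \<in> comm" "\<zeta> \<in> V" for C \<zeta>
    using comm_commute[OF comm_comp[OF E_comm that(1)] Y] that(2) by (simp add: V_iff)
  ultimately show ?thesis using bicomm_V[OF Y] by (simp add: corner_op_def)
qed

text \<open>Each E B C E commutes with \<open>X\<close>, so \<open>X\<close> moves in front of the
  whole sum. The compressions of \<open>val X L\<close> thus depend only on the vector represented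
  by \<open>L\<close>, not on the list.\<close>

lemma corner_compress:
  assumes X: "corner_op X" and B: "B \<in> comm"
  shows "valid L \<Longrightarrow> E (B (val X L)) = X (E (B (val (\<lambda>x. x) L)))"
proof (induction L)
  case Nil
  show ?case by (simp add: bounded_clinearD[OF comm_bounded[OF B]] E_linear
        clinear_onD[OF corner_opD(1)[OF X] csubspace_V])
next
  case (Cons p L)
  obtain C \<xi> where p: "p = (C, \<xi>)" by (cases p)
  have C: "C \<in> comm" "\<xi> \<in> V" "valid L" using Cons.prems by (auto simp: p)
  note lin = bounded_clinearD[OF comm_bounded[OF B]] E_linear
  have "E (B (C (X \<xi>))) = X (E (B (C \<xi>)))"
    using corner_opD(3)[OF X comm_comp[OF B C(1)] C(2)] .
  moreover have "E (B (C \<xi>)) \<in> V" "E (B (val (\<lambda>x. x) L)) \<in> V"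
    using C(2) V_iff by (blast intro: V_I comm_D[OF B] comm_D[OF C(1)] val_in_D[OF corner_op_id C(3)])+
  ultimately show ?case
    using Cons.IH[OF C(3)] by (simp add: p lin clinear_onD[OF corner_opD(1)[OF X] csubspace_V])
qed

text \<open>The frame operator of the analysis map sending y to the family of components
  \<open>E (adj C y)\<close>; \<open>frame_form\<close> is its quadratic form.\<close>

definition frame :: "('h \<Rightarrow> 'h) list \<Rightarrow> 'h \<Rightarrow> 'h" where
  "frame Cs y = (\<Sum>C\<leftarrow>Cs. C (E (adj C y)))"

definition frame_form :: "('h \<Rightarrow> 'h) list \<Rightarrow> 'h \<Rightarrow> real" where
  "frame_form Cs y = (\<Sum>C\<leftarrow>Cs. (norm (E (adj C y)))\<^sup>2)"

lemma frame_comm: "set Cs \<subseteq> comm \<Longrightarrow> frame Cs \<in> comm"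
proof (induction Cs)
  case Nil
  have "frame [] = (\<lambda>x. 0)" by (auto simp: frame_def)
  then show ?case using comm_zero by simp
next
  case (Cons C Cs)
  have "frame (C # Cs) = (\<lambda>y. C (E (adj C y)) + frame Cs y)" by (auto simp: frame_def)
  moreover have C: "C \<in> comm" and "frame Cs \<in> comm" using Cons by auto
  ultimately show ?case
    using comm_add[OF comm_comp[OF C comm_comp[OF E_comm adj(3)[OF C]]]] by simp
qed

lemma frame_selfadjoint: "set Cs \<subseteq> comm \<Longrightarrow> cinner (frame Cs y) z = cinner y (frame Cs z)"
  by (induction Cs) (auto simp: frame_def cinner_add_left cinner_add_right adj(1) E_cinner adj(2))

lemma cinner_frame: "set Cs \<subseteq> comm \<Longrightarrow> cinner y (frame Cs y) = complex_of_real (frame_form Cs y)"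
proof (induction Cs)
  case (Cons C Cs)
  have "cinner y (C (E (adj C y))) = cinner (adj C y) (E (E (adj C y)))"
    using Cons.prems by (simp add: adj(2) E_idem)
  also have "\<dots> = complex_of_real ((norm (E (adj C y)))\<^sup>2)"
    by (simp only: E_cinner[symmetric] cinner_self)
  finally show ?case using Cons by (simp add: frame_def frame_form_def cinner_add_right)
qed (simp add: frame_def frame_form_def)

lemma frame_form_nonneg: "0 \<le> frame_form Cs y"
  unfolding frame_form_def by (induction Cs) auto

text \<open>The inequality \<parallel>T y\<parallel>^2 \<le> K \<langle>T y, y\<rangle> for a
  bounded positive T, obtained by induction over the summands instead of through a square root of T.
  The factors 2 in \<open>K'\<close> come from \<parallel>u + v\<parallel>^2 \<le> 2
  \<parallel>u\<parallel>^2 + 2 \<parallel>v\<parallel>^2.\<close>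

lemma frame_bound:
  "set Cs \<subseteq> comm \<Longrightarrow> \<exists>K\<ge>0. \<forall>y. (norm (frame Cs y))\<^sup>2 \<le> K * frame_form Cs y"
proof (induction Cs)
  case Nil
  show ?case by (auto simp: frame_def frame_form_def)
next
  case (Cons C Cs)
  obtain K where K: "0 \<le> K" "\<And>y. (norm (frame Cs y))\<^sup>2 \<le> K * frame_form Cs y"
    using Cons by auto
  have "bounded_linear C" using Cons.prems by (simp add: bounded_clinearD(6) comm_bounded)
  then obtain k where k: "\<And>x. norm (C x) \<le> norm x * k" using bounded_linear.bounded by blast
  define K' where "K' = max (2 * k\<^sup>2) (2 * K)"
  have "(norm (frame (C # Cs) y))\<^sup>2 \<le> K' * frame_form (C # Cs) y" for y
  proof -
    let ?u = "E (adj C y)" and ?v = "frame Cs y"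
    have "(norm (C ?u))\<^sup>2 \<le> (norm ?u * k)\<^sup>2" using k by (intro power_mono) auto
    then have u: "(norm (C ?u))\<^sup>2 \<le> k\<^sup>2 * (norm ?u)\<^sup>2" by (simp add: power_mult_distrib mult.commute)
    have "(norm (C ?u + ?v))\<^sup>2 + (norm (C ?u - ?v))\<^sup>2 = 2 * (norm (C ?u))\<^sup>2 + 2 * (norm ?v)\<^sup>2"
      unfolding norm_add_square[of "C ?u"] norm_diff_square[of "C ?u"] by simp
    then have "(norm (C ?u + ?v))\<^sup>2 \<le> 2 * (norm (C ?u))\<^sup>2 + 2 * (norm ?v)\<^sup>2"
      using zero_le_power2[of "norm (C ?u - ?v)"] by linarith
    also have "\<dots> \<le> (2 * k\<^sup>2) * (norm ?u)\<^sup>2 + (2 * K) * frame_form Cs y"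
      using u K(2)[of y] by simp
    also have "\<dots> \<le> K' * (norm ?u)\<^sup>2 + K' * frame_form Cs y"
      using frame_form_nonneg by (intro add_mono mult_right_mono) (auto simp: K'_def)
    finally show ?thesis by (simp add: frame_def frame_form_def algebra_simps)
  qed
  moreover have "0 \<le> K'" using K(1) by (simp add: K'_def)
  ultimately show ?case by blast
qed

text \<open>The estimate rests on the operators \<open>T = a \<Sum>C E C\<^sup>*\<close> and \<open>Q = 1 - T\<close>: with
  \<open>t u = \<langle>T u, u\<rangle>\<close> one has \<open>t u \<le> \<parallel>u\<parallel>\<^sup>2 - \<parallel>Q u\<parallel>\<^sup>2 \<le> 2 t u\<close>, and summing over the orbit of \<open>Q\<close>
  recovers the full norm on the range of \<open>T\<close> from the corner components \<open>E C\<^sup>* Q\<^sup>m u\<close>, on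
  which \<open>X\<close> acts. This replaces a decomposition of the central support of \<open>E\<close> into
  partial isometries.\<close>

lemma corner_contraction:
  assumes Cs: "set Cs \<subseteq> comm"
  obtains a Q where "0 < a" "Q \<in> comm" "\<And>u v. cinner (Q u) v = cinner u (Q v)"
    "\<And>u. a * frame_form Cs u \<le> (norm u)\<^sup>2 - (norm (Q u))\<^sup>2"
    "\<And>u. (norm u)\<^sup>2 - (norm (Q u))\<^sup>2 \<le> 2 * (a * frame_form Cs u)"
proof -
  obtain K where K: "0 \<le> K" "\<And>y. (norm (frame Cs y))\<^sup>2 \<le> K * frame_form Cs y"
    using frame_bound[OF Cs] by blast
  \<comment> \<open>With a K \<le> 1 the quadratic term of \<parallel>u - a T u\<parallel>^2, T
    being the frame operator, is at most half of the linear one, which gives the lower bound; the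
    summand 1 covers K = 0.\<close>
  define a where "a = 1 / (K + 1)"
  have a: "0 < a" "a * K \<le> 1" using K(1) by (auto simp: a_def field_simps)
  define Q where "Q u = u + complex_of_real (- a) *\<^sub>C frame Cs u" for u
  have Qeq: "Q u = u - complex_of_real a *\<^sub>C frame Cs u" for u
    unfolding Q_def by (simp flip: scaleR_scaleC of_real_minus)
  have t: "(norm u)\<^sup>2 - (norm (Q u))\<^sup>2 = 2 * (a * frame_form Cs u) - a\<^sup>2 * (norm (frame Cs u))\<^sup>2" for u
    unfolding Qeq norm_diff_square using a(1)
    by (simp add: cinner_scaleC_right cinner_frame[OF Cs] norm_scaleC power_mult_distrib)
  have "a\<^sup>2 * (norm (frame Cs u))\<^sup>2 \<le> a * frame_form Cs u" for u
  proof -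
    have "a\<^sup>2 * (norm (frame Cs u))\<^sup>2 \<le> a\<^sup>2 * (K * frame_form Cs u)"
      by (intro mult_left_mono K) simp
    also have "\<dots> = (a * K) * (a * frame_form Cs u)" by (simp add: power2_eq_square)
    also have "\<dots> \<le> 1 * (a * frame_form Cs u)"
      using a frame_form_nonneg[of Cs u] by (intro mult_right_mono) auto
    finally show ?thesis by simp
  qed
  moreover have "0 \<le> a\<^sup>2 * (norm (frame Cs u))\<^sup>2" for u by simp
  ultimately have "a * frame_form Cs u \<le> (norm u)\<^sup>2 - (norm (Q u))\<^sup>2"
    "(norm u)\<^sup>2 - (norm (Q u))\<^sup>2 \<le> 2 * (a * frame_form Cs u)" for u
    unfolding t by (smt (verit))+
  moreover have "Q \<in> comm"
    unfolding Q_def by (intro comm_add comm_id comm_scaleC frame_comm Cs)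
  moreover have "cinner (Q u) v = cinner u (Q v)" for u v
    by (simp add: Qeq cinner_diff_left cinner_diff_right cinner_scaleC_left cinner_scaleC_right
        frame_selfadjoint[OF Cs])
  ultimately show thesis using that a(1) by blast
qed

text \<open>Since X \<xi> = E (X \<xi>), pairing with \<open>val X L\<close> sees only the
  components \<open>E (adj C (w m))\<close> for the finitely many \<open>C\<close> in
  \<open>L\<close>.\<close>

lemma cinner_val_tendsto_0:
  assumes X: "corner_op X"
    and w: "\<And>C. C \<in> fst ` set L \<Longrightarrow> (\<lambda>m. E (adj C (w m))) \<longlonglongrightarrow> 0"
  shows "valid L \<Longrightarrow> (\<lambda>m. cinner (w m) (val X L)) \<longlonglongrightarrow> 0"
  using w
proof (induction L)
  case (Cons p L)
  obtain C \<xi> where p: "p = (C, \<xi>)" by (cases p)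
  have C: "C \<in> comm" "valid L" "E (X \<xi>) = X \<xi>"
    using Cons.prems(1) corner_opD(2)[OF X, of \<xi>] by (auto simp: p V_iff)
  have "cinner (w m) (C (X \<xi>)) = cinner (E (adj C (w m))) (X \<xi>)" for m
    by (simp add: E_cinner C(3) adj(2)[OF C(1)])
  moreover have "(\<lambda>m. cinner (E (adj C (w m))) (X \<xi>)) \<longlonglongrightarrow> cinner 0 (X \<xi>)"
    by (intro tendsto_cinner tendsto_const Cons.prems(2)) (simp add: p)
  ultimately have "(\<lambda>m. cinner (w m) (C (X \<xi>))) \<longlonglongrightarrow> 0" by simp
  moreover have "(\<lambda>m. cinner (w m) (val X L)) \<longlonglongrightarrow> 0"
    using Cons.prems(2) by (intro Cons.IH C) auto
  ultimately have "(\<lambda>m. cinner (w m) (C (X \<xi>)) + cinner (w m) (val X L)) \<longlonglongrightarrow> 0 + 0"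
    by (rule tendsto_add)
  then show ?case by (simp add: p cinner_add_right)
qed simp

text \<open>The hypothesis applies to each corner component along the orbit of \<open>Q\<close>.
  Summation returns at most the full norms on the right and at least half of the norm on the left,
  up to a remainder that tends to 0; hence the factor 2, independent of \<open>L\<close>.\<close>

lemma val_bound:
  assumes X: "corner_op X" and Y: "\<And>i. i \<in> I \<Longrightarrow> Ys i \<in> M" and c: "0 \<le> c"
    and bound: "\<And>\<zeta>. \<zeta> \<in> V \<Longrightarrow> (norm (X \<zeta>))\<^sup>2 \<le> c * (\<Sum>i\<in>I. (norm (Ys i \<zeta>))\<^sup>2)"
    and L: "valid L"
  shows "(norm (val X L))\<^sup>2 \<le> 2 * c * (\<Sum>i\<in>I. (norm (Ys i (val (\<lambda>x. x) L)))\<^sup>2)"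
proof -
  define Cs where "Cs = map fst L"
  have Cs: "set Cs \<subseteq> comm" using L by (auto simp: Cs_def valid_def)
  from corner_contraction[OF Cs] obtain a Q where a: "0 < a" and Q: "Q \<in> comm"
    and Q_sa: "\<And>u v. cinner (Q u) v = cinner u (Q v)"
    and lower: "\<And>u. a * frame_form Cs u \<le> (norm u)\<^sup>2 - (norm (Q u))\<^sup>2"
    and upper: "\<And>u. (norm u)\<^sup>2 - (norm (Q u))\<^sup>2 \<le> 2 * (a * frame_form Cs u)"
    by blast
  define t where "t u = a * frame_form Cs u" for u
  have t0: "0 \<le> t u" for u using a frame_form_nonneg by (simp add: t_def)
  have orbit_le: "(\<Sum>m<n. t ((Q ^^ m) u)) \<le> (norm u)\<^sup>2 - (norm ((Q ^^ n) u))\<^sup>2" for n u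
  proof (induction n)
    case (Suc n)
    then show ?case using lower[of "(Q ^^ n) u"] by (simp add: t_def)
  qed simp
  have orbit_ge: "(norm u)\<^sup>2 - (norm ((Q ^^ n) u))\<^sup>2 \<le> 2 * (\<Sum>m<n. t ((Q ^^ m) u))" for n u
  proof (induction n)
    case (Suc n)
    then show ?case using upper[of "(Q ^^ n) u"] by (simp add: t_def)
  qed simp
  have Qn_sa: "cinner ((Q ^^ n) u) v = cinner u ((Q ^^ n) v)" for n u v
    by (induction n arbitrary: u v) (simp_all add: Q_sa, simp add: funpow_swap1)
  define x where "x = val X L"
  define z where "z = val (\<lambda>x. x) L"
  have zD: "z \<in> D" unfolding z_def by (rule val_in_D[OF corner_op_id L])
  have t_le: "t ((Q ^^ m) x) \<le> c * (\<Sum>i\<in>I. t ((Q ^^ m) (Ys i z)))" for m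
  proof -
    \<comment> \<open>The component of \<open>x\<close> is the image under \<open>X\<close> of the
      same component of \<open>z\<close>, which lies in \<open>V\<close>, where \<open>bound\<close>
      holds. The \<open>Ys i\<close> then pass through, because the component map lies in the
      commutant.\<close>
    have "(norm (E (adj C ((Q ^^ m) x))))\<^sup>2 \<le> c * (\<Sum>i\<in>I. (norm (E (adj C ((Q ^^ m) (Ys i z)))))\<^sup>2)"
      if "C \<in> set Cs" for C
    proof -
      have B: "(\<lambda>y. adj C ((Q ^^ m) y)) \<in> comm"
        by (rule comm_comp[OF adj(3) comm_funpow[OF Q]]) (use that Cs in auto)
      then have EB: "(\<lambda>y. E (adj C ((Q ^^ m) y))) \<in> comm"
        using comm_comp[OF E_comm] by simp
      have "(norm (E (adj C ((Q ^^ m) x))))\<^sup>2 = (norm (X (E (adj C ((Q ^^ m) z)))))\<^sup>2"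
        using corner_compress[OF X B L] by (simp add: x_def z_def)
      also have "\<dots> \<le> c * (\<Sum>i\<in>I. (norm (Ys i (E (adj C ((Q ^^ m) z)))))\<^sup>2)"
        by (intro bound V_I comm_D[OF B] zD)
      also have "(\<Sum>i\<in>I. (norm (Ys i (E (adj C ((Q ^^ m) z)))))\<^sup>2)
          = (\<Sum>i\<in>I. (norm (E (adj C ((Q ^^ m) (Ys i z)))))\<^sup>2)"
        using comm_alg_commute[OF EB Y zD] by (intro sum.cong) auto
      finally show ?thesis .
    qed
    then have "frame_form Cs ((Q ^^ m) x)
        \<le> (\<Sum>C\<leftarrow>Cs. c * (\<Sum>i\<in>I. (norm (E (adj C ((Q ^^ m) (Ys i z)))))\<^sup>2))"
      unfolding frame_form_def by (intro sum_list_mono)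
    also have "\<dots> = c * (\<Sum>i\<in>I. frame_form Cs ((Q ^^ m) (Ys i z)))"
      unfolding frame_form_def by (induction Cs) (simp_all add: sum.distrib distrib_left)
    finally have "a * frame_form Cs ((Q ^^ m) x) \<le> a * (c * (\<Sum>i\<in>I. frame_form Cs ((Q ^^ m) (Ys i z))))"
      using a by (intro mult_left_mono) auto
    then show ?thesis by (simp add: t_def sum_distrib_left mult.left_commute)
  qed
  have main: "(norm x)\<^sup>2 - (norm ((Q ^^ n) x))\<^sup>2 \<le> 2 * c * (\<Sum>i\<in>I. (norm (Ys i z))\<^sup>2)" for n
  proof -
    have "(\<Sum>m<n. t ((Q ^^ m) x)) \<le> (\<Sum>m<n. c * (\<Sum>i\<in>I. t ((Q ^^ m) (Ys i z))))"
      by (intro sum_mono t_le)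
    also have "\<dots> = c * (\<Sum>i\<in>I. \<Sum>m<n. t ((Q ^^ m) (Ys i z)))"
      by (subst sum.swap) (simp add: sum_distrib_left)
    also have "\<dots> \<le> c * (\<Sum>i\<in>I. (norm (Ys i z))\<^sup>2)"
    proof (intro mult_left_mono sum_mono c)
      fix i
      show "(\<Sum>m<n. t ((Q ^^ m) (Ys i z))) \<le> (norm (Ys i z))\<^sup>2"
        using orbit_le[where n = n and u = "Ys i z"] zero_le_power2[of "norm ((Q ^^ n) (Ys i z))"] by linarith
    qed
    finally show ?thesis using orbit_ge[of x n] by simp
  qed
  have "summable (\<lambda>m. t ((Q ^^ m) x))"
  proof (rule bounded_imp_summable[where B = "(norm x)\<^sup>2"])
    show "(\<Sum>m\<le>n. t ((Q ^^ m) x)) \<le> (norm x)\<^sup>2" for n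
      using orbit_le[of x "Suc n"] zero_le_power2[of "norm ((Q ^^ Suc n) x)"]
      unfolding lessThan_Suc_atMost by linarith
  qed (rule t0)
  then have t_lim: "(\<lambda>m. t ((Q ^^ m) x)) \<longlonglongrightarrow> 0" by (rule summable_LIMSEQ_zero)
  have "(\<lambda>m. E (adj C ((Q ^^ m) x))) \<longlonglongrightarrow> 0" if "C \<in> fst ` set L" for C
  proof -
    have "a * (norm (E (adj C u)))\<^sup>2 \<le> t u" for u
    proof -
      have "(norm (E (adj C u)))\<^sup>2 \<le> frame_form Cs u"
        unfolding frame_form_def using that by (intro member_le_sum_list) (auto simp: Cs_def)
      then show ?thesis using a by (simp add: t_def)
    qed
    then have "(\<lambda>m. a * (norm (E (adj C ((Q ^^ m) x))))\<^sup>2) \<longlonglongrightarrow> 0"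
      using a by (intro tendsto_sandwich[OF _ _ tendsto_const t_lim]) auto
    then have "(\<lambda>m. inverse a * (a * (norm (E (adj C ((Q ^^ m) x))))\<^sup>2)) \<longlonglongrightarrow> inverse a * 0"
      by (intro tendsto_mult tendsto_const)
    then have "(\<lambda>m. (norm (E (adj C ((Q ^^ m) x))))\<^sup>2) \<longlonglongrightarrow> 0" using a by simp
    then show ?thesis by (simp add: tendsto_norm_zero_iff)
  qed
  then have "(\<lambda>m. cinner ((Q ^^ m) x) x) \<longlonglongrightarrow> 0"
    unfolding x_def by (intro cinner_val_tendsto_0[OF X _ L])
  \<comment> \<open>\<open>Q\<close> is self-adjoint, so along even powers this inner product is the
    squared norm of \<open>(Q ^^ n) x\<close>: weak decay becomes norm decay.\<close>
  then have "(\<lambda>n. cinner ((Q ^^ (2 * n)) x) x) \<longlonglongrightarrow> 0"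
    using LIMSEQ_subseq_LIMSEQ[of _ 0 "\<lambda>n. 2 * n"] by (simp add: strict_mono_def comp_def)
  moreover have "cinner ((Q ^^ (2 * n)) x) x = complex_of_real ((norm ((Q ^^ n) x))\<^sup>2)" for n
    by (simp only: mult_2 funpow_add comp_apply Qn_sa[of n "(Q ^^ n) x"] cinner_self)
  ultimately have "(\<lambda>n. complex_of_real ((norm ((Q ^^ n) x))\<^sup>2)) \<longlonglongrightarrow> complex_of_real 0" by simp
  then have "(\<lambda>n. (norm ((Q ^^ n) x))\<^sup>2) \<longlonglongrightarrow> 0" by (simp only: tendsto_of_real_iff)
  then have "(\<lambda>n. (norm x)\<^sup>2 - (norm ((Q ^^ n) x))\<^sup>2) \<longlonglongrightarrow> (norm x)\<^sup>2 - 0"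
    by (intro tendsto_diff tendsto_const)
  then have "(norm x)\<^sup>2 - 0 \<le> 2 * c * (\<Sum>i\<in>I. (norm (Ys i z))\<^sup>2)"
    using main by (intro LIMSEQ_le_const2) auto
  then show ?thesis by (simp add: x_def z_def)
qed

end

subsection \<open>Graph-topology bounds on the span\<close>

lemma Cauchy_if_seminorm_bound:
  fixes g :: "nat \<Rightarrow> nat \<Rightarrow> 'a::real_normed_vector" and h :: "nat \<Rightarrow> 'b::real_normed_vector"
  assumes g: "\<And>k. Cauchy (g k)"
    and h: "\<And>i j. norm (h i - h j) \<le> c * (\<Sum>k\<le>n. norm (g k i - g k j))" and c: "0 \<le> c"
  shows "Cauchy h"
proof (rule CauchyI)
  fix e :: real assume e: "0 < e"
  \<comment> \<open>\<open>n + 1\<close> counts the seminorms; \<open>c + 1\<close> keeps the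
    denominator positive for c = 0 and makes the final inequality strict.\<close>
  define d where "d = e / ((c + 1) * (real n + 1))"
  have d: "0 < d" using e c by (simp add: d_def)
  have "\<forall>k. \<exists>N. \<forall>i\<ge>N. \<forall>j\<ge>N. norm (g k i - g k j) < d" using CauchyD[OF g d] by blast
  then obtain N where N: "\<And>k i j. N k \<le> i \<Longrightarrow> N k \<le> j \<Longrightarrow> norm (g k i - g k j) < d" by metis
  have "norm (h i - h j) < e" if ij: "(\<Sum>k\<le>n. N k) \<le> i" "(\<Sum>k\<le>n. N k) \<le> j" for i j
  proof -
    have "norm (g k i - g k j) \<le> d" if "k \<in> {..n}" for k
    proof -
      have "N k \<le> (\<Sum>k\<le>n. N k)" using that by (intro member_le_sum) auto
      then show ?thesis using N[of k i j] ij by simp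
    qed
    then have "(\<Sum>k\<le>n. norm (g k i - g k j)) \<le> of_nat (card {..n}) * d" by (rule sum_bounded_above)
    then have "c * (\<Sum>k\<le>n. norm (g k i - g k j)) \<le> c * ((real n + 1) * d)"
      using c by (intro mult_left_mono) (auto simp: add.commute)
    also have "\<dots> < (c + 1) * ((real n + 1) * d)" using d by (simp add: algebra_simps add_pos_nonneg)
    also have "\<dots> = e" using c by (simp add: d_def)
    finally show ?thesis using h[of i j] by linarith
  qed
  then show "\<exists>M. \<forall>m\<ge>M. \<forall>n\<ge>M. norm (h m - h n) < e" by blast
qed

context invariant_commutant
begin

text \<open>The choice is made once, so that all later bounds and limits refer to the same countable
  family.\<close>

definition seminorm_op :: "nat \<Rightarrow> 'h \<Rightarrow> 'h" where
  "seminorm_op = (SOME Ys. range Ys \<subseteq> M \<and> Ys 0 = idD D \<and>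
    (\<forall>X\<in>M. \<exists>n c. 0 \<le> c \<and> (\<forall>\<xi>\<in>D. norm (X \<xi>) \<le> c * (\<Sum>k\<le>n. norm (Ys k \<xi>)))))"

lemma seminorm_op:
  shows "seminorm_op k \<in> M" "\<xi> \<in> D \<Longrightarrow> seminorm_op 0 \<xi> = \<xi>"
    "X \<in> M \<Longrightarrow> \<exists>n c. 0 \<le> c \<and> (\<forall>\<xi>\<in>D. norm (X \<xi>) \<le> c * (\<Sum>k\<le>n. norm (seminorm_op k \<xi>)))"
proof -
  have "\<exists>Ys. range Ys \<subseteq> M \<and> Ys (0::nat) = idD D \<and>
    (\<forall>X\<in>M. \<exists>n c. 0 \<le> c \<and> (\<forall>\<xi>\<in>D. norm (X \<xi>) \<le> c * (\<Sum>k\<le>n. norm (Ys k \<xi>))))"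
    by (rule graph_metrizable_from_identity) (rule exI, intro conjI ballI)
  from someI_ex[OF this] have *: "range seminorm_op \<subseteq> M \<and> seminorm_op 0 = idD D \<and>
    (\<forall>X\<in>M. \<exists>n c. 0 \<le> c \<and> (\<forall>\<xi>\<in>D. norm (X \<xi>) \<le> c * (\<Sum>k\<le>n. norm (seminorm_op k \<xi>))))"
    unfolding seminorm_op_def[symmetric] .
  show "seminorm_op k \<in> M" using conjunct1[OF *] by (simp add: image_subset_iff)
  show "\<xi> \<in> D \<Longrightarrow> seminorm_op 0 \<xi> = \<xi>" using * by (simp add: idD_def)
  show "X \<in> M \<Longrightarrow> \<exists>n c. 0 \<le> c \<and> (\<forall>\<xi>\<in>D. norm (X \<xi>) \<le> c * (\<Sum>k\<le>n. norm (seminorm_op k \<xi>)))"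
    using * by simp
qed

lemma alg_linear: "X \<in> M \<Longrightarrow> clinear_on D X"
  by (rule LdagD(1)[OF alg_Ldag])

lemma graph_Cauchy:
  assumes f: "\<And>n. f n \<in> D" "\<And>k. Cauchy (\<lambda>n. seminorm_op k (f n))" and X: "X \<in> M"
  shows "Cauchy (\<lambda>n. X (f n))"
proof -
  obtain n c where c: "0 \<le> c" "\<And>\<xi>. \<xi> \<in> D \<Longrightarrow> norm (X \<xi>) \<le> c * (\<Sum>k\<le>n. norm (seminorm_op k \<xi>))"
    using seminorm_op(3)[OF X] by blast
  show ?thesis
  proof (rule Cauchy_if_seminorm_bound[OF f(2) _ c(1)])
    fix i j
    have "f i - f j \<in> D" using f(1) csubspaceD(5)[OF csubspace_D] by blast
    from c(2)[OF this]
    show "norm (X (f i) - X (f j)) \<le> c * (\<Sum>k\<le>n. norm (seminorm_op k (f i) - seminorm_op k (f j)))"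
      using f(1) by (simp add: clinear_onD(4)[OF alg_linear csubspace_D] X seminorm_op(1))
  qed
qed

end

section \<open>Formally adjoint pairs on the corner\<close>

context reduction
begin

text \<open>The adjoint is explicit data, constrained only on \<open>V\<close>, so that pairs can be
  swapped and composed without computing a \<open>dagger\<close>.\<close>

definition corner_pair :: "('h \<Rightarrow> 'h) \<Rightarrow> ('h \<Rightarrow> 'h) \<Rightarrow> bool" where
  "corner_pair X X' \<longleftrightarrow> corner_op X \<and> (\<forall>y\<in>V. X' y \<in> V) \<and> (\<forall>x\<in>V. \<forall>y\<in>V. cinner (X x) y = cinner x (X' y))"

lemma corner_pairD:
  assumes "corner_pair X X'"
  shows "corner_op X" "y \<in> V \<Longrightarrow> X' y \<in> V" "x \<in> V \<Longrightarrow> y \<in> V \<Longrightarrow> cinner (X x) y = cinner x (X' y)"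
  using assms unfolding corner_pair_def by blast+

lemma eq_on_V:
  assumes "u \<in> V" "v \<in> V" "\<And>x. x \<in> V \<Longrightarrow> cinner u x = cinner v x"
  shows "u = v"
proof -
  have "u - v \<in> V" using assms csubspaceD(5)[OF csubspace_V] by blast
  then have "cinner (u - v) (u - v) = 0" using assms(3)[of "u - v"] by (simp add: cinner_diff_left)
  then show ?thesis by (simp add: cinner_eq_zero_iff)
qed

text \<open>Everything dualises: the commutation of \<open>X'\<close> with the compression of
  \<open>C\<close> is that of \<open>X\<close> with the compression of \<open>adj C\<close>.\<close>

lemma corner_pair_sym:
  assumes P: "corner_pair X X'"
  shows "corner_pair X' X"
proof -
  note X = corner_opD[OF corner_pairD(1)[OF P]] and Vs = csubspaceD[OF csubspace_V]
  have dual: "cinner (X' y) x = cinner y (X x)" if "x \<in> V" "y \<in> V" for x y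
    by (subst (1 2) cinner_commute) (simp add: corner_pairD(3)[OF P that])
  have "clinear_on V X'"
    unfolding clinear_on_def
  proof (intro conjI ballI allI)
    fix x y a assume xy: "x \<in> V"
    show "X' (a *\<^sub>C x) = a *\<^sub>C X' x"
      using xy by (intro eq_on_V) (simp_all add: Vs corner_pairD(2)[OF P] dual cinner_scaleC_left)
    assume y: "y \<in> V"
    show "X' (x + y) = X' x + X' y"
      using xy y by (intro eq_on_V) (simp_all add: Vs corner_pairD(2)[OF P] dual cinner_add_left)
  qed
  moreover have "E (C (X' \<zeta>)) = X' (E (C \<zeta>))" if C: "C \<in> comm" and \<zeta>: "\<zeta> \<in> V" for C \<zeta>
  proof (rule eq_on_V)
    have EC: "E (B \<xi>) \<in> V" if "B \<in> comm" "\<xi> \<in> V" for B \<xi>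
      using that comm_D by (simp add: V_iff E_idem comm_D[OF E_comm])
    show "E (C (X' \<zeta>)) \<in> V" "X' (E (C \<zeta>)) \<in> V"
      using EC[OF C] corner_pairD(2)[OF P] \<zeta> by blast+
    fix x assume x: "x \<in> V"
    have Ex: "E x = x" and EX: "E (X x) = X x" using x X(2)[OF x] by (simp_all add: V_iff)
    have E\<zeta>: "E \<zeta> = \<zeta>" "E (X' \<zeta>) = X' \<zeta>"
      using \<zeta> corner_pairD(2)[OF P \<zeta>] by (simp_all add: V_iff)
    have "cinner (E (C (X' \<zeta>))) x = cinner (C (X' \<zeta>)) x" by (simp add: E_cinner Ex)
    also have "\<dots> = cinner (E (X' \<zeta>)) (adj C x)" by (simp add: adj(1)[OF C] E\<zeta>)
    also have "\<dots> = cinner (X' \<zeta>) (E (adj C x))" by (rule E_cinner)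
    also have "\<dots> = cinner \<zeta> (E (adj C (X x)))"
      using dual[OF EC[OF adj(3)[OF C] x] \<zeta>] X(3)[OF adj(3)[OF C] x] by simp
    also have "\<dots> = cinner (E \<zeta>) (adj C (X x))" by (rule E_cinner[symmetric])
    also have "\<dots> = cinner (C \<zeta>) (E (X x))" by (simp add: adj(1)[OF C] E\<zeta> EX)
    also have "\<dots> = cinner (E (C \<zeta>)) (X x)" by (rule E_cinner[symmetric])
    also have "\<dots> = cinner (X' (E (C \<zeta>))) x" using dual[OF x EC[OF C \<zeta>]] by simp
    finally show "cinner (E (C (X' \<zeta>))) x = cinner (X' (E (C \<zeta>))) x" .
  qed
  ultimately show ?thesis
    using X(2) corner_pairD(2)[OF P] dual by (simp add: corner_pair_def corner_op_def)
qed

text \<open>Applied to all \<open>Y\<close> in the algebra, this upgrades a norm bound on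
  \<open>val X L\<close> to a bound on every graph seminorm.\<close>

lemma corner_pair_alg_comp:
  assumes P: "corner_pair X X'" and Y: "Y \<in> M"
  shows "corner_pair (\<lambda>x. Y (X x)) (\<lambda>y. X' (dagger D Y y))"
proof -
  have dY: "dagger D Y y \<in> V" if "y \<in> V" for y
    using bicomm_V[OF alg_subset_bicomm[OF alg_dagger[OF Y]] that] .
  have "cinner (Y (X x)) y = cinner x (X' (dagger D Y y))" if "x \<in> V" "y \<in> V" for x y
  proof -
    have "cinner (Y (X x)) y = cinner (X x) (dagger D Y y)"
      using dagger(2)[OF csubspace_D alg_Ldag[OF Y], of y "X x"] that
        corner_opD(2)[OF corner_pairD(1)[OF P] that(1)] by (simp add: V_iff)
    then show ?thesis using corner_pairD(3)[OF P that(1) dY[OF that(2)]] by simp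
  qed
  then show ?thesis
    using corner_op_comp[OF corner_op_bicomm[OF alg_subset_bicomm[OF Y]] corner_pairD(1)[OF P]]
      dY corner_pairD(2)[OF P] by (simp add: corner_pair_def)
qed

lemma corner_complete:
  assumes f: "\<And>n. f n \<in> V" "\<And>k. Cauchy (\<lambda>n. seminorm_op k (f n))"
  shows "\<exists>x\<in>V. f \<longlonglongrightarrow> x"
proof -
  have fD: "f n \<in> D" "E (f n) = f n" for n using f(1)[of n] by (simp_all add: V_iff)
  obtain \<xi> where \<xi>: "\<xi> \<in> D" "\<And>X. X \<in> M \<Longrightarrow> (\<lambda>n. X (f n)) \<longlonglongrightarrow> X \<xi>"
    using graph_complete_sequence[where f = f, OF fD(1) graph_Cauchy[OF fD(1) f(2)]] by blast
  have lim: "f \<longlonglongrightarrow> \<xi>" using \<xi>(2)[OF alg_id] \<xi>(1) fD(1) by (simp add: idD_def)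
  then have "(\<lambda>n. E (f n)) \<longlonglongrightarrow> E \<xi>" by (rule bounded_linear.tendsto[OF E_linear(6)])
  then have "E \<xi> = \<xi>" using lim LIMSEQ_unique by (simp add: fD(2))
  then show ?thesis using \<xi>(1) lim V_iff by blast
qed

text \<open>Automatic continuity on \<open>V\<close>, carried over to lists by
  \<open>val_bound\<close>. In particular \<open>val X L\<close> vanishes whenever the vector
  represented by \<open>L\<close> does.\<close>

lemma val_seminorm_bound:
  assumes P: "corner_pair X X'"
  shows "\<exists>n c. 0 \<le> c \<and> (\<forall>L. valid L \<longrightarrow> norm (val X L) \<le> c * (\<Sum>k\<le>n. norm (seminorm_op k (val (\<lambda>x. x) L))))"
proof -
  note X = corner_opD[OF corner_pairD(1)[OF P]]
  have "clinear_on V (seminorm_op k)" for k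
    using corner_opD(1)[OF corner_op_bicomm[OF alg_subset_bicomm[OF seminorm_op(1)]]] .
  moreover have "seminorm_op 0 x = x" if "x \<in> V" for x using that by (simp add: V_iff seminorm_op(2))
  ultimately obtain n c where c: "0 \<le> c" "\<And>x. x \<in> V \<Longrightarrow> norm (X x) \<le> c * (\<Sum>k\<le>n. norm (seminorm_op k x))"
    using adjointable_seminorm_bound[where Ys = seminorm_op and X = X and X' = X',
        OF csubspace_V _ _ corner_complete X(1) X(2) corner_pairD(3)[OF P]]
    by blast
  \<comment> \<open>Cauchy-Schwarz: the square of a sum of n + 1 seminorms is at most n + 1 times
    the sum of their squares.\<close>
  define b where "b = c\<^sup>2 * (real n + 1)"
  have b0: "0 \<le> b" by (simp add: b_def)
  have sq: "(norm (X x))\<^sup>2 \<le> b * (\<Sum>k\<le>n. (norm (seminorm_op k x))\<^sup>2)" if "x \<in> V" for x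
  proof -
    have "(norm (X x))\<^sup>2 \<le> (c * (\<Sum>k\<le>n. norm (seminorm_op k x)))\<^sup>2"
      by (intro power_mono c that) simp
    also have "\<dots> \<le> c\<^sup>2 * ((real n + 1) * (\<Sum>k\<le>n. (norm (seminorm_op k x))\<^sup>2))"
      using sum_squared_le_sum_of_squares[of "\<lambda>k. norm (seminorm_op k x)" "{..n}"]
      unfolding power_mult_distrib by (intro mult_left_mono) (simp_all add: ac_simps)
    finally show ?thesis by (simp add: b_def)
  qed
  have "norm (val X L) \<le> sqrt (2 * b) * (\<Sum>k\<le>n. norm (seminorm_op k (val (\<lambda>x. x) L)))" if "valid L" for L
  proof -
    let ?s = "\<lambda>k. norm (seminorm_op k (val (\<lambda>x. x) L))"
    have "(norm (val X L))\<^sup>2 \<le> 2 * b * (\<Sum>k\<le>n. (?s k)\<^sup>2)"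
      using val_bound[OF corner_pairD(1)[OF P] seminorm_op(1) b0 sq that] .
    then have "norm (val X L) \<le> sqrt (2 * b) * sqrt (\<Sum>k\<le>n. (?s k)\<^sup>2)"
      by (simp add: real_le_rsqrt flip: real_sqrt_mult)
    also have "sqrt (\<Sum>k\<le>n. (?s k)\<^sup>2) \<le> (\<Sum>k\<le>n. ?s k)"
      using L2_set_le_sum[of "{..n}" ?s] by (simp add: L2_set_def)
    finally show ?thesis using b0 by (simp add: mult_left_mono)
  qed
  then show ?thesis using b0 by (intro exI[of _ n] exI[of _ "sqrt (2 * b)"]) simp
qed

text \<open>Moving \<open>C\<close> to the left turns \<open>val X L\<close> into a compression,
  where \<open>corner_compress\<close> brings \<open>X\<close> outside and the adjoint relation on
  \<open>V\<close> applies.\<close>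

lemma cinner_val_dual:
  assumes P: "corner_pair X X'" and L: "valid L"
  shows "valid L' \<Longrightarrow> cinner (val X L) (val (\<lambda>x. x) L') = cinner (val (\<lambda>x. x) L) (val X' L')"
proof (induction L')
  case (Cons p L')
  obtain C \<xi> where p: "p = (C, \<xi>)" by (cases p)
  have C: "C \<in> comm" "\<xi> \<in> V" "valid L'" using Cons.prems by (auto simp: p)
  let ?z = "val (\<lambda>x. x) L"
  have zV: "E (adj C ?z) \<in> V" by (intro V_I comm_D[OF adj(3)[OF C(1)]] val_in_D[OF corner_op_id L])
  have E\<xi>: "E \<xi> = \<xi>" "E (X' \<xi>) = X' \<xi>"
    using C(2) corner_pairD(2)[OF P C(2)] by (simp_all add: V_iff)
  have "cinner (val X L) (C \<xi>) = cinner (E (adj C (val X L))) \<xi>"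
    by (simp add: E_cinner E\<xi> adj(2)[OF C(1)])
  also have "\<dots> = cinner (X (E (adj C ?z))) \<xi>"
    using corner_compress[OF corner_pairD(1)[OF P] adj(3)[OF C(1)] L] by simp
  also have "\<dots> = cinner (E (adj C ?z)) (X' \<xi>)" by (rule corner_pairD(3)[OF P zV C(2)])
  also have "\<dots> = cinner ?z (C (X' \<xi>))" by (simp add: E_cinner E\<xi> adj(2)[OF C(1)])
  finally show ?case using Cons.IH[OF C(3)] by (simp add: p cinner_add_right)
qed simp

section \<open>The span \<open>S\<close> and the projection onto its closure\<close>

definition S :: "'h set" where
  "S = cspan {C (E \<xi>) | C \<xi>. C \<in> comm \<and> \<xi> \<in> D}"

lemma csubspace_S: "csubspace S"
  unfolding S_def by (rule csubspace_cspan)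

lemma S_iff: "s \<in> S \<longleftrightarrow> (\<exists>L. valid L \<and> s = val (\<lambda>x. x) L)"
proof
  define R where "R = {val (\<lambda>x. x) L | L. valid L}"
  have "csubspace R"
    unfolding csubspace_def
  proof (intro conjI ballI allI)
    show "0 \<in> R" unfolding R_def by (rule CollectI, rule exI[of _ "[]"]) simp
    fix x a assume "x \<in> R"
    then obtain L where L: "valid L" "x = val (\<lambda>x. x) L" by (auto simp: R_def)
    \<comment> \<open>Lists carry no coefficients; the scalar is absorbed as a multiple of the
      identity, an element of the commutant.\<close>
    show "a *\<^sub>C x \<in> R"
      unfolding R_def using valid_left_mult[OF comm_scaleC[OF comm_id, of a] L(1)]
        val_left_mult[OF bounded_clinear_scaleC[OF bounded_clinear_id, of a], of "\<lambda>x. x" L] L(2) by force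
    fix y assume "y \<in> R"
    then obtain L' where L': "valid L'" "y = val (\<lambda>x. x) L'" by (auto simp: R_def)
    show "x + y \<in> R"
      unfolding R_def using L L' by (intro CollectI exI[of _ "L @ L'"]) (simp add: val_append valid_append)
  qed
  moreover have "{C (E \<xi>) | C \<xi>. C \<in> comm \<and> \<xi> \<in> D} \<subseteq> R"
  proof clarify
    fix C \<xi> assume "C \<in> comm" "\<xi> \<in> D"
    then show "C (E \<xi>) \<in> R"
      unfolding R_def by (intro CollectI exI[of _ "[(C, E \<xi>)]"]) (simp add: V_I)
  qed
  ultimately have "S \<subseteq> R" unfolding S_def by (rule cspan_minimal[rotated])
  then show "s \<in> S \<Longrightarrow> \<exists>L. valid L \<and> s = val (\<lambda>x. x) L" by (auto simp: R_def)
next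
  have "valid L \<Longrightarrow> val (\<lambda>x. x) L \<in> S" for L
  proof (induction L)
    case (Cons p L)
    obtain C \<xi> where p: "p = (C, \<xi>)" by (cases p)
    then have C: "C \<in> comm" "\<xi> \<in> D" "E \<xi> = \<xi>" "valid L" using Cons.prems by (auto simp: V_iff)
    then have "C (E \<xi>) \<in> S" unfolding S_def by (intro subsetD[OF cspan_superset]) blast
    then have "C \<xi> \<in> S" by (simp add: C(3))
    then show ?case using Cons.IH[OF \<open>valid L\<close>] csubspaceD(2)[OF csubspace_S] by (simp add: p)
  qed (simp add: csubspaceD(1)[OF csubspace_S])
  then show "\<exists>L. valid L \<and> s = val (\<lambda>x. x) L \<Longrightarrow> s \<in> S" by blast
qed

lemma comm_S: "C \<in> comm \<Longrightarrow> s \<in> S \<Longrightarrow> C s \<in> S"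
  unfolding S_iff using valid_left_mult val_left_mult[OF comm_bounded] by metis

lemma comm_closure_S: "C \<in> comm \<Longrightarrow> s \<in> closure S \<Longrightarrow> C s \<in> closure S"
proof -
  assume C: "C \<in> comm" and "s \<in> closure S"
  then obtain f where f: "\<And>n. f n \<in> S" "f \<longlonglongrightarrow> s" by (auto simp: closure_sequential)
  have "(\<lambda>n. C (f n)) \<longlonglongrightarrow> C s"
    by (rule bounded_linear.tendsto[OF bounded_clinearD(6)[OF comm_bounded[OF C]] f(2)])
  then show "C s \<in> closure S" unfolding closure_sequential using comm_S[OF C f(1)] by (intro exI[of _ "\<lambda>n. C (f n)"]) simp
qed

lemma V_subset_S: "v \<in> V \<Longrightarrow> v \<in> S"
  unfolding S_iff by (rule exI[of _ "[(\<lambda>x. x, v)]"]) (simp add: comm_id)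

abbreviation Z :: "'h \<Rightarrow> 'h" where "Z \<equiv> cproj S"

text \<open>\<open>S\<close> is invariant under \<open>C\<close> and under \<open>adj C\<close>, so
  its closure reduces \<open>C\<close>.\<close>

lemma Z_commute:
  assumes C: "C \<in> comm"
  shows "Z (C x) = C (Z x)"
proof (rule cproj_unique[OF csubspace_S])
  show "C (Z x) \<in> closure S" by (rule comm_closure_S[OF C cproj(1)[OF csubspace_S]])
  fix s assume "s \<in> S"
  then have "adj C s \<in> closure S" using comm_S[OF adj(3)[OF C]] closure_subset by blast
  then have "cinner (x - Z x) (adj C s) = 0" by (rule cproj(2)[OF csubspace_S])
  then show "cinner (C x - C (Z x)) s = 0"
    by (simp add: adj(1)[OF C] bounded_clinearD(5)[OF comm_bounded[OF C], symmetric])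
qed

lemma Z_id: "s \<in> closure S \<Longrightarrow> Z s = s"
  by (rule cproj_unique[OF csubspace_S]) simp_all

end

context invariant_commutant
begin

text \<open>Essential self-adjointness yields an approximating sequence for one operator at a time.
  A sum of the identity and finitely many terms Y^\<dagger> Y lets one operator control finitely
  many seminorms.\<close>

lemma dominating_operator:
  "finite J \<Longrightarrow> J \<subseteq> M \<Longrightarrow>
    \<exists>R\<in>M. \<forall>u\<in>D. 0 \<le> Re (cinner (R u) u) \<and> (\<forall>Y\<in>J. (norm (Y u))\<^sup>2 \<le> Re (cinner (R u) u))"
proof (induction J rule: finite_induct)
  case empty
  show ?case by (rule bexI[OF _ alg_id]) (simp add: idD_def cinner_nonneg)
next
  case (insert Y J)
  then obtain R where R: "R \<in> M" "\<And>u. u \<in> D \<Longrightarrow> 0 \<le> Re (cinner (R u) u)"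
      "\<And>u X. u \<in> D \<Longrightarrow> X \<in> J \<Longrightarrow> (norm (X u))\<^sup>2 \<le> Re (cinner (R u) u)" by blast
  have Y: "Y \<in> M" using insert.prems by simp
  define R' where "R' u = R u + (dagger D Y \<circ> Y) u" for u
  have "R' \<in> M" unfolding R'_def by (intro alg_add alg_comp alg_dagger R Y)
  moreover have eq: "Re (cinner (R' u) u) = Re (cinner (R u) u) + (norm (Y u))\<^sup>2" if "u \<in> D" for u
  proof -
    have "cinner (dagger D Y (Y u)) u = cnj (cinner (Y u) (Y u))"
      using dagger(2)[OF csubspace_D alg_Ldag[OF Y] LdagD(2)[OF alg_Ldag[OF Y] that] that]
      by (simp add: cinner_commute[of _ u])
    then show ?thesis by (simp add: R'_def cinner_add_left cinner_self flip: of_real_power)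
  qed
  ultimately show ?case
    using R(2,3) by (intro bexI[of _ R']) (auto simp: eq intro: add_increasing2)
qed

end

subsection \<open>Extension to the whole domain\<close>

locale ess_sa_reduction = reduction D M E for D :: "'h::chilbert set" and M E +
  assumes ess_sa: "ess_sa_subspace D bicomm S"
begin

lemma S_subset_D: "s \<in> S \<Longrightarrow> s \<in> D"
  and bicomm_S: "X \<in> bicomm \<Longrightarrow> s \<in> S \<Longrightarrow> X s \<in> S"
  using ess_sa by (auto simp: ess_sa_subspace_def)

text \<open>Every \<open>Z \<xi>\<close> lies in the domains of the adjoints, hence by essential self-adjointness
  in the domains of the closures.\<close>

lemma Z_closure_dom:
  assumes \<xi>: "\<xi> \<in> D" and Y: "Y \<in> bicomm"
  shows "\<exists>f. (\<forall>n. f n \<in> S) \<and> f \<longlonglongrightarrow> Z \<xi> \<and> convergent (\<lambda>n. Y (f n))"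
proof -
  have "Z \<xi> \<in> adj_dom S (\<lambda>x. if x \<in> S then X x else 0)" if X: "X \<in> bicomm" for X
  proof -
    have "cinner (X s) (Z \<xi>) = cinner s (Z (dagger D X \<xi>))" if s: "s \<in> S" for s
    proof -
      have cl: "X s \<in> closure S" "s \<in> closure S" using bicomm_S[OF X s] s closure_subset by blast+
      have "cinner (X s) (Z \<xi>) = cinner (X s) \<xi>" by (rule cproj_cinner(2)[OF csubspace_S cl(1)])
      also have "\<dots> = cinner s (dagger D X \<xi>)"
        by (rule dagger(2)[OF csubspace_D bicomm_Ldag[OF X] \<xi> S_subset_D[OF s]])
      also have "\<dots> = cinner s (Z (dagger D X \<xi>))"
        by (rule cproj_cinner(2)[OF csubspace_S cl(2), symmetric])
      finally show ?thesis .
    qed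
    then show ?thesis
      unfolding adj_dom_def using cproj(1)[OF csubspace_S] by auto
  qed
  then have "Z \<xi> \<in> (\<Inter>X\<in>(\<lambda>X x. if x \<in> S then X x else 0) ` bicomm. adj_dom S X)" by blast
  also have "\<dots> = (\<Inter>X\<in>(\<lambda>X x. if x \<in> S then X x else 0) ` bicomm. closure_dom S X)"
    using ess_sa by (simp only: ess_sa_subspace_def ess_self_adjoint_def)
  finally have "Z \<xi> \<in> closure_dom S (\<lambda>x. if x \<in> S then Y x else 0)" using Y by blast
  then show ?thesis by (auto simp: closure_dom_def)
qed

text \<open>Membership of Z \<eta> in the adjoint domain tests only against \<open>S\<close>.
  Membership in the domain of the closure supplies approximants \<open>f n\<close> in
  \<open>S\<close>, on which \<open>dagger D X\<close> can be moved against an arbitrary \<xi> in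
  \<open>D\<close>.\<close>

lemma Z_comm: "Z \<in> comm"
proof -
  have "cinner (Z (X \<xi>)) \<eta> = cinner (Z \<xi>) (dagger D X \<eta>)" if X: "X \<in> M" and \<xi>: "\<xi> \<in> D" and \<eta>: "\<eta> \<in> D" for X \<xi> \<eta>
  proof -
    note dX = alg_subset_bicomm[OF alg_dagger[OF X]]
    note adjX = dagger(2)[OF csubspace_D alg_Ldag[OF X]]
    obtain f v where f: "\<And>n. f n \<in> S" "f \<longlonglongrightarrow> Z \<eta>" "(\<lambda>n. dagger D X (f n)) \<longlonglongrightarrow> v"
      using Z_closure_dom[OF \<eta> dX] by (auto simp: convergent_def)
    note fD = S_subset_D[OF f(1)]
    \<comment> \<open>Pairing with s in \<open>S\<close> identifies the limit: \<langle>s,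
      v\<rangle> = \<langle>X s, Z \<eta>\<rangle> = \<langle>X s, \<eta>\<rangle>, because X s lies
      in \<open>S\<close>.\<close>
    have "Z (dagger D X \<eta>) = v"
    proof (rule cproj_unique[OF csubspace_S])
      show "v \<in> closure S"
        unfolding closure_sequential using f bicomm_S[OF dX f(1)]
        by (intro exI[of _ "\<lambda>n. dagger D X (f n)"]) simp
      fix s assume s: "s \<in> S"
      have "(\<lambda>n. cinner s (dagger D X (f n))) \<longlonglongrightarrow> cinner s v"
        by (intro tendsto_cinner tendsto_const f)
      moreover have "cinner s (dagger D X (f n)) = cinner (X s) (f n)" for n
        using adjX[OF fD S_subset_D[OF s]] by simp
      moreover have "(\<lambda>n. cinner (X s) (f n)) \<longlonglongrightarrow> cinner (X s) (Z \<eta>)"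
        by (intro tendsto_cinner tendsto_const f)
      ultimately have "cinner s v = cinner (X s) (Z \<eta>)" using LIMSEQ_unique by simp
      also have "\<dots> = cinner (X s) \<eta>"
        using bicomm_S[OF alg_subset_bicomm[OF X] s] closure_subset
        by (intro cproj_cinner(2)[OF csubspace_S]) blast
      also have "\<dots> = cinner s (dagger D X \<eta>)" by (rule adjX[OF \<eta> S_subset_D[OF s]])
      finally show "cinner (dagger D X \<eta> - v) s = 0"
        by (simp add: cinner_commute[of _ s] cinner_diff_right)
    qed
    moreover have "cinner (Z (X \<xi>)) \<eta> = cinner \<xi> v"
    proof -
      have "cinner (Z (X \<xi>)) \<eta> = cinner (X \<xi>) (Z \<eta>)"
        using cproj_cinner[OF csubspace_S cproj(1)[OF csubspace_S]] by metis
      moreover have "(\<lambda>n. cinner (X \<xi>) (f n)) \<longlonglongrightarrow> cinner (X \<xi>) (Z \<eta>)"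
        by (intro tendsto_cinner tendsto_const f)
      moreover have "cinner (X \<xi>) (f n) = cinner \<xi> (dagger D X (f n))" for n by (rule adjX[OF fD \<xi>])
      moreover have "(\<lambda>n. cinner \<xi> (dagger D X (f n))) \<longlonglongrightarrow> cinner \<xi> v"
        by (intro tendsto_cinner tendsto_const f)
      ultimately show ?thesis using LIMSEQ_unique by simp
    qed
    moreover have "cinner \<xi> (Z (dagger D X \<eta>)) = cinner (Z \<xi>) (dagger D X \<eta>)"
      using cproj_cinner[OF csubspace_S cproj(1)[OF csubspace_S]] by metis
    ultimately show ?thesis by simp
  qed
  then show ?thesis using bounded_clinear_cproj[OF csubspace_S] by (simp add: wcomm_def)
qed

lemma Z_D: "\<xi> \<in> D \<Longrightarrow> Z \<xi> \<in> D"
  by (rule comm_D[OF Z_comm])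

lemma S_graph_dense:
  assumes \<xi>: "\<xi> \<in> D" and J: "finite J" "J \<subseteq> M" and e: "0 < e"
  shows "\<exists>s\<in>S. \<forall>Y\<in>J. norm (Y s - Y (Z \<xi>)) < e"
proof -
  obtain R where R: "R \<in> M" "\<And>u Y. u \<in> D \<Longrightarrow> Y \<in> J \<Longrightarrow> (norm (Y u))\<^sup>2 \<le> Re (cinner (R u) u)"
    using dominating_operator[OF J] by blast
  obtain f v where f: "\<And>n. f n \<in> S" "f \<longlonglongrightarrow> Z \<xi>" "(\<lambda>n. R (f n)) \<longlonglongrightarrow> v"
    using Z_closure_dom[OF \<xi> alg_subset_bicomm[OF R(1)]] by (auto simp: convergent_def)
  note fD = S_subset_D[OF f(1)] and ZD = Z_D[OF \<xi>]
  \<comment> \<open>Whatever the limit \<open>v\<close> is, the other factor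
    \<open>f n - Z \<xi>\<close> tends to 0, and so does the quadratic form that dominates the
    seminorms.\<close>
  have "(\<lambda>n. Re (cinner (R (f n) - R (Z \<xi>)) (f n - Z \<xi>))) \<longlonglongrightarrow> Re (cinner (v - R (Z \<xi>)) (Z \<xi> - Z \<xi>))"
    by (intro tendsto_intros tendsto_cinner f)
  then have "\<forall>\<^sub>F n in sequentially. Re (cinner (R (f n) - R (Z \<xi>)) (f n - Z \<xi>)) < e\<^sup>2"
    using e by (intro order_tendstoD(2)) auto
  then obtain n where n: "Re (cinner (R (f n) - R (Z \<xi>)) (f n - Z \<xi>)) < e\<^sup>2"
    by (auto simp: eventually_sequentially)
  have "norm (Y (f n) - Y (Z \<xi>)) < e" if Y: "Y \<in> J" for Y
  proof -
    have "(norm (Y (f n - Z \<xi>)))\<^sup>2 \<le> Re (cinner (R (f n - Z \<xi>)) (f n - Z \<xi>))"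
      by (intro R(2) Y csubspaceD(5)[OF csubspace_D] fD ZD)
    then have "(norm (Y (f n) - Y (Z \<xi>)))\<^sup>2 < e\<^sup>2"
      using n Y J(2) R(1) clinear_onD(4)[OF alg_linear csubspace_D fD ZD] by (auto simp: subset_iff)
    then show ?thesis using e by (meson less_le power2_less_imp_less)
  qed
  then show ?thesis using f(1) by blast
qed

text \<open>Norm convergence is all that duality, and with it uniqueness, requires; graph
  convergence enters only in the proof of existence.\<close>

definition extends_to :: "('h \<Rightarrow> 'h) \<Rightarrow> 'h \<Rightarrow> 'h \<Rightarrow> bool" where
  "extends_to X \<xi> w \<longleftrightarrow> w \<in> D \<and> (\<exists>L. (\<forall>n::nat. valid (L n)) \<and> (\<lambda>n. val (\<lambda>x. x) (L n)) \<longlonglongrightarrow> Z \<xi>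
    \<and> (\<lambda>n. val X (L n)) \<longlonglongrightarrow> w)"

lemma extends_toI:
  assumes "w \<in> D" "\<And>n::nat. valid (L n)" "(\<lambda>n. val (\<lambda>x. x) (L n)) \<longlonglongrightarrow> Z \<xi>" "(\<lambda>n. val X (L n)) \<longlonglongrightarrow> w"
  shows "extends_to X \<xi> w"
  using assms unfolding extends_to_def by blast

lemma extends_toE:
  assumes "extends_to X \<xi> w"
  obtains L where "w \<in> D" "\<And>n::nat. valid (L n)" "(\<lambda>n. val (\<lambda>x. x) (L n)) \<longlonglongrightarrow> Z \<xi>" "(\<lambda>n. val X (L n)) \<longlonglongrightarrow> w"
  using assms unfolding extends_to_def by blast

lemma extends_to_exists:
  assumes P: "corner_pair X X'" and \<xi>: "\<xi> \<in> D"
  shows "\<exists>w. extends_to X \<xi> w"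
proof -
  \<comment> \<open>Diagonal choice: the n-th list is within 1/(n + 1) for the seminorms up to n, so
    each single seminorm converges.\<close>
  have "\<forall>n. \<exists>L. valid L \<and> (\<forall>Y\<in>seminorm_op ` {..n}. norm (Y (val (\<lambda>x. x) L) - Y (Z \<xi>)) < inverse (real (Suc n)))"
  proof
    fix n
    have "seminorm_op ` {..n} \<subseteq> M" using seminorm_op(1) by blast
    then show "\<exists>L. valid L \<and> (\<forall>Y\<in>seminorm_op ` {..n}. norm (Y (val (\<lambda>x. x) L) - Y (Z \<xi>)) < inverse (real (Suc n)))"
      using S_graph_dense[OF \<xi>, of "seminorm_op ` {..n}" "inverse (real (Suc n))"] 
      by (metis S_iff finite_atMost finite_imageI inverse_positive_iff_positive of_nat_0_less_iff zero_less_Suc)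
  qed
  from choice[OF this] obtain L where L: "\<And>n. valid (L n)"
    and near: "\<And>n k. k \<le> n \<Longrightarrow> norm (seminorm_op k (val (\<lambda>x. x) (L n)) - seminorm_op k (Z \<xi>)) < inverse (real (Suc n))"
    by auto
  let ?f = "\<lambda>n. val (\<lambda>x. x) (L n)"
  have fD: "?f n \<in> D" for n by (rule val_in_D[OF corner_op_id L])
  have lim: "(\<lambda>n. seminorm_op k (?f n)) \<longlonglongrightarrow> seminorm_op k (Z \<xi>)" for k
  proof -
    have "\<forall>\<^sub>F n in sequentially. norm (seminorm_op k (?f n) - seminorm_op k (Z \<xi>)) \<le> inverse (real (Suc n))"
      using eventually_ge_at_top[of k] by eventually_elim (rule less_imp_le[OF near])
    then have "(\<lambda>n. seminorm_op k (?f n) - seminorm_op k (Z \<xi>)) \<longlonglongrightarrow> 0"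
      by (rule Lim_null_comparison[OF _ LIMSEQ_inverse_real_of_nat])
    then show ?thesis by (simp add: LIM_zero_iff)
  qed
  have "Cauchy (\<lambda>n. Y (val X (L n)))" if Y: "Y \<in> M" for Y
  proof -
    obtain n c where c: "0 \<le> c" "\<And>L. valid L \<Longrightarrow> norm (val (\<lambda>x. Y (X x)) L) \<le> c * (\<Sum>k\<le>n. norm (seminorm_op k (val (\<lambda>x. x) L)))"
      using val_seminorm_bound[OF corner_pair_alg_comp[OF P Y]] by blast
    have "Cauchy (\<lambda>n. val (\<lambda>x. Y (X x)) (L n))"
    proof (rule Cauchy_if_seminorm_bound[OF LIMSEQ_imp_Cauchy[OF lim] _ c(1)])
      fix i j
      \<comment> \<open>One list representing the difference, so that the bound for lists becomes a
        Cauchy estimate.\<close>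
      define N where "N = L i @ left_mult (\<lambda>x. (-1) *\<^sub>C x) (L j)"
      have N: "valid N"
        unfolding N_def valid_append using L valid_left_mult[OF comm_scaleC[OF comm_id]] by simp
      have valN: "val A N = val A (L i) - val A (L j)" for A
        using val_left_mult[OF bounded_clinear_scaleC[OF bounded_clinear_id], of A "-1" "L j"]
        by (simp add: N_def val_append scaleC_minus_one)
      show "norm (val (\<lambda>x. Y (X x)) (L i) - val (\<lambda>x. Y (X x)) (L j))
          \<le> c * (\<Sum>k\<le>n. norm (seminorm_op k (?f i) - seminorm_op k (?f j)))"
        using c(2)[OF N] clinear_onD(4)[OF alg_linear[OF seminorm_op(1)] csubspace_D fD fD]
        by (simp add: valN)
    qed
    then show ?thesis
      using bicomm_val[OF alg_subset_bicomm[OF Y] corner_pairD(1)[OF P] L] by simp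
  qed
  then obtain w where w: "w \<in> D" "\<And>Y. Y \<in> M \<Longrightarrow> (\<lambda>n. Y (val X (L n))) \<longlonglongrightarrow> Y w"
    using graph_complete_sequence[where f = "\<lambda>n. val X (L n)", OF val_in_D[OF corner_pairD(1)[OF P] L]] by blast
  have "extends_to X \<xi> w"
  proof (rule extends_toI[OF w(1) L])
    show "?f \<longlonglongrightarrow> Z \<xi>" using lim[of 0] fD Z_D[OF \<xi>] by (simp add: seminorm_op(2))
    show "(\<lambda>n. val X (L n)) \<longlonglongrightarrow> w"
      using w(2)[OF alg_id] w(1) val_in_D[OF corner_pairD(1)[OF P] L] by (simp add: idD_def)
  qed
  then show ?thesis by blast
qed

lemma extends_to_closure:
  assumes P: "corner_pair X X'" and w: "extends_to X \<xi> w"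
  shows "w \<in> closure S"
proof -
  obtain L where L: "\<And>n::nat. valid (L n)" "(\<lambda>n. val X (L n)) \<longlonglongrightarrow> w" using w by (rule extends_toE) blast
  have "val X L' \<in> S" if "valid L'" for L'
    using that
  proof (induction L')
    case (Cons p L')
    obtain C \<zeta> where p: "p = (C, \<zeta>)" by (cases p)
    then have "C \<in> comm" "\<zeta> \<in> V" "valid L'" using Cons.prems by auto
    then have "C (X \<zeta>) \<in> S" "val X L' \<in> S"
      using comm_S V_subset_S corner_opD(2)[OF corner_pairD(1)[OF P]] Cons.IH by auto
    then show ?case using csubspaceD(2)[OF csubspace_S] by (simp add: p)
  qed (simp add: csubspaceD(1)[OF csubspace_S])
  then show ?thesis
    unfolding closure_sequential using L by (intro exI[of _ "\<lambda>n. val X (L n)"]) simp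
qed

text \<open>\<open>cinner_val_dual\<close> passes to the limit with Z \<xi> and Z \<eta>; since
  \<open>w\<close> and \<open>v\<close> lie in the closure of \<open>S\<close>, both projections
  disappear.\<close>

lemma extends_to_dual:
  assumes P: "corner_pair X X'" and w: "extends_to X \<xi> w" and v: "extends_to X' \<eta> v"
  shows "cinner w \<eta> = cinner \<xi> v"
proof -
  obtain L where L: "\<And>n::nat. valid (L n)" "(\<lambda>n. val (\<lambda>x. x) (L n)) \<longlonglongrightarrow> Z \<xi>" "(\<lambda>n. val X (L n)) \<longlonglongrightarrow> w"
    using w by (rule extends_toE) blast
  obtain L' where L': "\<And>n::nat. valid (L' n)" "(\<lambda>n. val (\<lambda>x. x) (L' n)) \<longlonglongrightarrow> Z \<eta>" "(\<lambda>n. val X' (L' n)) \<longlonglongrightarrow> v"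
    using v by (rule extends_toE) blast
  have "(\<lambda>n. cinner (val X (L n)) (val (\<lambda>x. x) (L' n))) \<longlonglongrightarrow> cinner w (Z \<eta>)"
    by (intro tendsto_cinner L L')
  moreover have "(\<lambda>n. cinner (val (\<lambda>x. x) (L n)) (val X' (L' n))) \<longlonglongrightarrow> cinner (Z \<xi>) v"
    by (intro tendsto_cinner L L')
  ultimately have "cinner w (Z \<eta>) = cinner (Z \<xi>) v"
    using cinner_val_dual[OF P L(1) L'(1)] LIMSEQ_unique by simp
  then show ?thesis
    using cproj_cinner(2)[OF csubspace_S extends_to_closure[OF P w], of \<eta>]
      cproj_cinner(1)[OF csubspace_S extends_to_closure[OF corner_pair_sym[OF P] v], of \<xi>] by simp
qed

lemma extends_to_unique:
  assumes P: "corner_pair X X'" and w: "extends_to X \<xi> w" "extends_to X \<xi> w'"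
  shows "w = w'"
proof (rule eq_if_cinner_eq_on_D)
  fix \<eta> assume "\<eta> \<in> D"
  then obtain v where "extends_to X' \<eta> v" using extends_to_exists[OF corner_pair_sym[OF P]] by blast
  then show "cinner w \<eta> = cinner w' \<eta>" using extends_to_dual[OF P] w by metis
qed

lemma extends_to_add:
  assumes "extends_to X \<xi> w" "extends_to X \<eta> v"
  shows "extends_to X (\<xi> + \<eta>) (w + v)"
proof -
  obtain L where L: "w \<in> D" "\<And>n::nat. valid (L n)" "(\<lambda>n. val (\<lambda>x. x) (L n)) \<longlonglongrightarrow> Z \<xi>" "(\<lambda>n. val X (L n)) \<longlonglongrightarrow> w"
    using assms(1) by (rule extends_toE) blast
  obtain L' where L': "v \<in> D" "\<And>n::nat. valid (L' n)" "(\<lambda>n. val (\<lambda>x. x) (L' n)) \<longlonglongrightarrow> Z \<eta>" "(\<lambda>n. val X (L' n)) \<longlonglongrightarrow> v"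
    using assms(2) by (rule extends_toE) blast
  show ?thesis
  proof (rule extends_toI)
    show "w + v \<in> D" by (rule csubspaceD(2)[OF csubspace_D L(1) L'(1)])
    show "valid (L n @ L' n)" for n using L(2) L'(2) by (simp add: valid_append)
    show "(\<lambda>n. val (\<lambda>x. x) (L n @ L' n)) \<longlonglongrightarrow> Z (\<xi> + \<eta>)"
      unfolding val_append bounded_clinearD(1)[OF bounded_clinear_cproj[OF csubspace_S]]
      by (rule tendsto_add[OF L(3) L'(3)])
    show "(\<lambda>n. val X (L n @ L' n)) \<longlonglongrightarrow> w + v"
      unfolding val_append by (rule tendsto_add[OF L(4) L'(4)])
  qed
qed

text \<open>Besides commutation, a scalar \<open>C\<close> gives homogeneity of the
  extension.\<close>

lemma extends_to_comm:
  assumes C: "C \<in> comm" and w: "extends_to X \<xi> w"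
  shows "extends_to X (C \<xi>) (C w)"
proof -
  obtain L where L: "w \<in> D" "\<And>n::nat. valid (L n)" "(\<lambda>n. val (\<lambda>x. x) (L n)) \<longlonglongrightarrow> Z \<xi>" "(\<lambda>n. val X (L n)) \<longlonglongrightarrow> w"
    using w by (rule extends_toE) blast
  note lim = bounded_linear.tendsto[OF bounded_clinearD(6)[OF comm_bounded[OF C]]]
  show ?thesis
  proof (rule extends_toI)
    show "C w \<in> D" by (rule comm_D[OF C L(1)])
    show "valid (left_mult C (L n))" for n by (rule valid_left_mult[OF C L(2)])
    show "(\<lambda>n. val (\<lambda>x. x) (left_mult C (L n))) \<longlonglongrightarrow> Z (C \<xi>)"
      unfolding val_left_mult[OF comm_bounded[OF C]] Z_commute[OF C] by (rule lim[OF L(3)])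
    show "(\<lambda>n. val X (left_mult C (L n))) \<longlonglongrightarrow> C w"
      unfolding val_left_mult[OF comm_bounded[OF C]] by (rule lim[OF L(4)])
  qed
qed

lemma extends_to_V:
  assumes P: "corner_pair X X'" and \<xi>: "\<xi> \<in> V"
  shows "extends_to X \<xi> (X \<xi>)"
proof (rule extends_toI[where L = "\<lambda>n. [(\<lambda>x. x, \<xi>)]"])
  show "X \<xi> \<in> D" using corner_opD(2)[OF corner_pairD(1)[OF P] \<xi>] by (simp add: V_iff)
  have "\<xi> \<in> closure S" using V_subset_S[OF \<xi>] closure_subset by blast
  then show "(\<lambda>n. val (\<lambda>x. x) [(\<lambda>x. x, \<xi>)]) \<longlonglongrightarrow> Z \<xi>" by (simp add: Z_id)
qed (simp_all add: comm_id \<xi>)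

section \<open>The extended operator and its membership in the bicommutant\<close>

definition extension :: "('h \<Rightarrow> 'h) \<Rightarrow> 'h \<Rightarrow> 'h" where
  "extension X \<xi> = (if \<xi> \<in> D then SOME w. extends_to X \<xi> w else 0)"

lemma extension_extends:
  assumes "corner_pair X X'" "\<xi> \<in> D"
  shows "extends_to X \<xi> (extension X \<xi>)"
  using someI_ex[OF extends_to_exists[OF assms]] assms(2) by (simp add: extension_def)

lemma extension_eqI:
  assumes "corner_pair X X'" "\<xi> \<in> D" "extends_to X \<xi> w"
  shows "extension X \<xi> = w"
  using extends_to_unique[OF assms(1) extension_extends[OF assms(1,2)] assms(3)] .

lemma extension_bicomm:
  assumes P: "corner_pair X X'"
  shows "extension X \<in> bicomm"
proof -
  note P' = corner_pair_sym[OF P]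
  note ext = extension_extends[OF P] and ext' = extension_extends[OF P']
  note Ds = csubspaceD[OF csubspace_D]
  have in_D: "extension X \<xi> \<in> D" if "\<xi> \<in> D" for \<xi>
    using ext[OF that] by (simp add: extends_to_def)
  have in_D': "extension X' \<xi> \<in> D" if "\<xi> \<in> D" for \<xi>
    using ext'[OF that] by (simp add: extends_to_def)
  have dual: "cinner (extension X \<xi>) \<eta> = cinner \<xi> (extension X' \<eta>)" if "\<xi> \<in> D" "\<eta> \<in> D" for \<xi> \<eta>
    by (rule extends_to_dual[OF P ext[OF that(1)] ext'[OF that(2)]])
  have "extension X (\<xi> + \<eta>) = extension X \<xi> + extension X \<eta>" if "\<xi> \<in> D" "\<eta> \<in> D" for \<xi> \<eta>
    by (rule extension_eqI[OF P Ds(2)[OF that] extends_to_add[OF ext[OF that(1)] ext[OF that(2)]]])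
  moreover have "extension X (a *\<^sub>C \<xi>) = a *\<^sub>C extension X \<xi>" if "\<xi> \<in> D" for a \<xi>
    by (rule extension_eqI[OF P Ds(3)[OF that] extends_to_comm[OF comm_scaleC[OF comm_id] ext[OF that]]])
  ultimately have Ldag: "extension X \<in> Ldag UNIV D"
    using in_D in_D' dual unfolding Ldag_def by (auto simp: extension_def)
  have "cinner (C (extension X \<xi>)) \<eta> = cinner (C \<xi>) (dagger D (extension X) \<eta>)"
    if C: "C \<in> comm" and \<xi>: "\<xi> \<in> D" and \<eta>: "\<eta> \<in> D" for C \<xi> \<eta>
  proof -
    have "dagger D (extension X) \<eta> = extension X' \<eta>"
      by (rule dagger_eqI[OF csubspace_D \<eta> in_D'[OF \<eta>] dual[OF _ \<eta>]])
    moreover have "extension X (C \<xi>) = C (extension X \<xi>)"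
      by (rule extension_eqI[OF P comm_D[OF C \<xi>] extends_to_comm[OF C ext[OF \<xi>]]])
    ultimately show ?thesis using dual[OF comm_D[OF C \<xi>] \<eta>] by simp
  qed
  then show ?thesis using Ldag by (simp add: wcc_def)
qed

lemma extension_on_V: "corner_pair X X' \<Longrightarrow> \<xi> \<in> V \<Longrightarrow> extension X \<xi> = X \<xi>"
  by (rule extension_eqI[OF _ _ extends_to_V]) (simp_all add: V_iff)

end

subsection \<open>The reduced algebra\<close>

context reduction
begin

definition restr :: "('h \<Rightarrow> 'h) \<Rightarrow> 'h \<Rightarrow> 'h" where
  "restr Y = (\<lambda>x. if x \<in> V then Y (E x) else 0)"

lemma reduced_eq: "reduced E D N = restr ` N"
  by (simp add: reduced_def restr_def V_def)

lemma restr_V: "\<xi> \<in> V \<Longrightarrow> restr Y \<xi> = Y \<xi>"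
  by (simp add: restr_def V_iff)

text \<open>In the adjoint formula the outer \<open>E\<close> brings the vector into
  \<open>V\<close>; it crosses the inner product freely because E \<xi> = \<xi> there.\<close>

lemma restr_Ldag:
  assumes Y: "Y \<in> bicomm"
  shows "restr Y \<in> Ldag (range E) V"
    and "\<eta> \<in> V \<Longrightarrow> dagger V (restr Y) \<eta> = E (dagger D Y \<eta>)"
proof -
  note YL = bicomm_Ldag[OF Y] and op = corner_opD[OF corner_op_bicomm[OF Y]]
  have dual: "E (dagger D Y \<eta>) \<in> V" "\<And>\<xi>. \<xi> \<in> V \<Longrightarrow> cinner (restr Y \<xi>) \<eta> = cinner \<xi> (E (dagger D Y \<eta>))"
    if "\<eta> \<in> V" for \<eta>
  proof -
    have \<eta>: "\<eta> \<in> D" using that by (simp add: V_iff)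
    show "E (dagger D Y \<eta>) \<in> V" by (intro V_I dagger(1)[OF csubspace_D YL \<eta>])
    fix \<xi> assume \<xi>: "\<xi> \<in> V"
    have "cinner (Y \<xi>) \<eta> = cinner (E \<xi>) (dagger D Y \<eta>)"
      using dagger(2)[OF csubspace_D YL \<eta>] \<xi> by (simp add: V_iff)
    then show "cinner (restr Y \<xi>) \<eta> = cinner \<xi> (E (dagger D Y \<eta>))"
      by (simp add: restr_V[OF \<xi>] E_cinner)
  qed
  show "\<eta> \<in> V \<Longrightarrow> dagger V (restr Y) \<eta> = E (dagger D Y \<eta>)"
    using dual by (intro dagger_eqI[OF csubspace_V])
  have "restr Y x = 0" if "x \<notin> V" for x using that by (simp add: restr_def)
  moreover have "\<forall>x\<in>V. \<forall>y\<in>V. restr Y (x + y) = restr Y x + restr Y y"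
    "\<forall>a. \<forall>x\<in>V. restr Y (a *\<^sub>C x) = a *\<^sub>C restr Y x"
    using op(1) csubspaceD[OF csubspace_V] by (simp_all add: restr_V clinear_on_def)
  moreover have "restr Y ` V \<subseteq> V" using op(2) by (auto simp: restr_V)
  ultimately show "restr Y \<in> Ldag (range E) V"
    unfolding Ldag_def using dual by blast
qed

text \<open>\<open>X\<close> commutes with \<open>E\<close>, so the relation for \<open>X\<close> on
  \<open>D\<close> reduces to one on \<open>V\<close>. Elements of the bicommutant can thus be
  tested against the corner.\<close>

lemma compression_comm:
  assumes C: "C \<in> wcomm (range E) V (reduced E D M)"
  shows "(\<lambda>x. E (C (E x))) \<in> comm"
proof -
  have "cinner (E (C (E (X \<xi>)))) \<eta> = cinner (E (C (E \<xi>))) (dagger D X \<eta>)"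
    if X: "X \<in> M" and \<xi>: "\<xi> \<in> D" and \<eta>: "\<eta> \<in> D" for X \<xi> \<eta>
  proof -
    note XB = alg_subset_bicomm[OF X]
    have "cinner (E (C (E (X \<xi>)))) \<eta> = cinner (C (restr X (E \<xi>))) (E \<eta>)"
      using comm_commute[OF E_comm XB \<xi>] by (simp add: E_cinner restr_V[OF V_I[OF \<xi>]])
    also have "\<dots> = cinner (C (E \<xi>)) (dagger V (restr X) (E \<eta>))"
      using C X V_I[OF \<xi>] V_I[OF \<eta>] by (simp add: wcomm_def reduced_eq)
    also have "dagger V (restr X) (E \<eta>) = E (dagger D X (E \<eta>))"
      by (rule restr_Ldag(2)[OF XB V_I[OF \<eta>]])
    also have "\<dots> = E (dagger D X \<eta>)"
      using comm_alg_commute[OF E_comm alg_dagger[OF X] \<eta>] E_idem by metis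
    finally show ?thesis by (simp add: E_cinner)
  qed
  moreover have "bounded_clinear (\<lambda>x. E (C (E x)))"
    using C by (intro bounded_clinear_comp[OF E_bounded] bounded_clinear_comp[OF _ E_bounded]) (simp add: wcomm_def)
  ultimately show ?thesis by (simp add: wcomm_def)
qed

lemma restr_wcc:
  assumes Y: "Y \<in> bicomm"
  shows "restr Y \<in> wcc (range E) V (reduced E D M)"
proof -
  have "cinner (C (restr Y \<xi>)) \<eta> = cinner (C \<xi>) (dagger V (restr Y) \<eta>)"
    if C: "C \<in> wcomm (range E) V (reduced E D M)" and \<xi>: "\<xi> \<in> V" and \<eta>: "\<eta> \<in> V" for C \<xi> \<eta>
  proof -
    have e: "E \<xi> = \<xi>" "E \<eta> = \<eta>" "\<xi> \<in> D" "\<eta> \<in> D" using \<xi> \<eta> by (simp_all add: V_iff)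
    have EY: "E (Y \<xi>) = Y \<xi>" using bicomm_V[OF Y \<xi>] by (simp add: V_iff)
    have "cinner (C (restr Y \<xi>)) \<eta> = cinner (E (C (E (Y \<xi>)))) \<eta>"
      by (simp add: restr_V[OF \<xi>] EY E_cinner e)
    also have "\<dots> = cinner (E (C (E \<xi>))) (dagger D Y \<eta>)"
      using Y compression_comm[OF C] e by (auto simp: wcc_def)
    also have "\<dots> = cinner (C \<xi>) (dagger V (restr Y) \<eta>)"
      by (simp add: e E_cinner restr_Ldag(2)[OF Y \<eta>])
    finally show ?thesis .
  qed
  then show ?thesis using restr_Ldag(1)[OF Y] by (simp add: wcc_def)
qed

text \<open>For \<open>B\<close> in the commutant, E B E lies in the weak commutant of the reduced
  algebra. The weak relation with \<open>X\<close> becomes an equality because E (B \<zeta>) stays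
  in \<open>V\<close>.\<close>

lemma wcc_corner_pair:
  assumes X: "X \<in> wcc (range E) V (reduced E D M)"
  shows "corner_pair X (dagger V X)"
proof -
  have XL: "X \<in> Ldag (range E) V" using X by (simp add: wcc_def)
  note dX = dagger[OF csubspace_V XL] and XV = LdagD(2)[OF XL]
  have "E (B (X \<zeta>)) = X (E (B \<zeta>))" if B: "B \<in> comm" and \<zeta>: "\<zeta> \<in> V" for B \<zeta>
  proof -
    have EB: "(\<lambda>x. E (B x)) \<in> comm" by (rule comm_comp[OF E_comm B])
    have EBV: "E (B v) \<in> V" if "v \<in> V" for v using that by (intro V_I comm_D[OF B]) (simp add: V_iff)
    have "(\<lambda>x. E (B (E x))) \<in> wcomm (range E) V (reduced E D M)"
    proof -
      have "cinner (E (B (E (restr Y \<xi>)))) \<eta> = cinner (E (B (E \<xi>))) (dagger V (restr Y) \<eta>)"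
        if Y: "Y \<in> M" and \<xi>: "\<xi> \<in> V" and \<eta>: "\<eta> \<in> V" for Y \<xi> \<eta>
      proof -
        note YB = alg_subset_bicomm[OF Y]
        have e: "E \<xi> = \<xi>" "\<xi> \<in> D" "\<eta> \<in> D" using \<xi> \<eta> by (simp_all add: V_iff)
        have EY: "E (Y \<xi>) = Y \<xi>" using bicomm_V[OF YB \<xi>] by (simp add: V_iff)
        have "cinner (E (B (E (restr Y \<xi>)))) \<eta> = cinner (Y (E (B \<xi>))) \<eta>"
          using comm_alg_commute[OF EB Y e(2)] by (simp add: restr_V[OF \<xi>] EY)
        also have "\<dots> = cinner (E (B \<xi>)) (dagger D Y \<eta>)"
          using dagger(2)[OF csubspace_D alg_Ldag[OF Y] e(3)] EBV[OF \<xi>] by (simp add: V_iff)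
        also have "\<dots> = cinner (E (B (E \<xi>))) (dagger V (restr Y) \<eta>)"
          by (simp add: restr_Ldag(2)[OF YB \<eta>] e(1) E_cinner E_idem)
        finally show ?thesis .
      qed
      moreover have "bounded_clinear (\<lambda>x. E (B (E x)))"
        by (rule bounded_clinear_comp[OF comm_bounded[OF EB] E_bounded])
      ultimately show ?thesis unfolding wcomm_def reduced_eq by auto
    qed
    then have *: "cinner (E (B (E (X \<zeta>)))) \<eta> = cinner (E (B (E \<zeta>))) (dagger V X \<eta>)" if "\<eta> \<in> V" for \<eta>
      using X \<zeta> that by (auto simp: wcc_def)
    have e: "E \<zeta> = \<zeta>" "E (X \<zeta>) = X \<zeta>" using \<zeta> XV[OF \<zeta>] by (simp_all add: V_iff)
    show ?thesis
    proof (rule eq_on_V)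
      show "E (B (X \<zeta>)) \<in> V" "X (E (B \<zeta>)) \<in> V" using EBV XV \<zeta> by blast+
      show "cinner (E (B (X \<zeta>))) \<eta> = cinner (X (E (B \<zeta>))) \<eta>" if "\<eta> \<in> V" for \<eta>
        using *[OF that] dX(2)[OF that EBV[OF \<zeta>]] by (simp add: e)
    qed
  qed
  then show ?thesis
    using LdagD(1)[OF XL] XV dX by (simp add: corner_pair_def corner_op_def)
qed

end

theorem theorem2p4:
  fixes D :: "'h::chilbert set" and M :: "('h \<Rightarrow> 'h) set" and E :: "'h \<Rightarrow> 'h"
  assumes "dense_domain UNIV D"
    and "closed_Oalg UNIV D M"
    and "frechet_domain D M"
    and "\<forall>C\<in>wcomm UNIV D M. C ` D \<subseteq> D"
    and "is_projection E" and "E \<in> wcomm UNIV D M"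
    and "ess_sa_subspace D (wcc UNIV D M) (cspan {C (E \<xi>) | C \<xi>. C \<in> wcomm UNIV D M \<and> \<xi> \<in> D})"
  shows "wcc (range E) (E ` D) (reduced E D M) = reduced E D (wcc UNIV D M)"
proof -
  interpret reduction D M E
    using assms(1-6) by unfold_locales
  interpret ess_sa_reduction D M E
    using assms(7) by unfold_locales (simp add: S_def)
  have "wcc (range E) V (reduced E D M) = restr ` bicomm"
  proof
    show "restr ` bicomm \<subseteq> wcc (range E) V (reduced E D M)" using restr_wcc by blast
    show "wcc (range E) V (reduced E D M) \<subseteq> restr ` bicomm"
    proof
      fix X assume X: "X \<in> wcc (range E) V (reduced E D M)"
      note P = wcc_corner_pair[OF X]
      \<comment> \<open>On \<open>V\<close> the extension agrees with \<open>X\<close>; outside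
        \<open>V\<close> both sides are 0 by normalisation.\<close>
      have "X x = restr (extension X) x" for x
        using LdagD(3)[of X "range E" V x] X extension_on_V[OF P, of x]
        by (cases "x \<in> V") (simp_all add: restr_V, simp add: restr_def wcc_def)
      then show "X \<in> restr ` bicomm" using extension_bicomm[OF P] by blast
    qed
  qed
  then show ?thesis by (simp only: V_def reduced_eq)
qed

end
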